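(* Let $I\subseteq\overline{\mathbb R}[x_1,\dots,x_n]$ be a tropical ideal. Then the variety $V(I)\subseteq\overline{\mathbb R}^n$ is empty if and only if $I$ is the unit ideal $\langle 0\rangle$ (where $0\in\mathbb R$ is the multiplicative identity of $\overline{\mathbb R}$, so that $\langle 0\rangle=\overline{\mathbb R}[x_1,\dots,x_n]$).
   Context: $\overline{\mathbb R} = (\mathbb R\cup\{\infty\},\oplus,\odot)$ is the tropical semiring with $\oplus=\min$, $\odot=+$. $\overline{\mathbb R}[x_1,\dots,x_n]$ is the semiring of (formal) polynomials with coefficients in $\overline{\mathbb R}$, with tropical operations; polynomials are not identified with functions. $[f]_{\mathbf x^{\mathbf u}}$ denotes the coefficient of $\mathbf x^{\mathbf u}$ in $f$ (equal to $\infty$ if the monomial does not occur). An ideal of a semiring is a nonempty subset closed under addition and under multiplication by arbitrary elements of the semiring. For an ideal $I$, $I_{\le d}$ is the set of polynomials in $I$ of degree at most $d$. Tropical ideal: an ideal $I\subseteq\overline{\mathbb R}[x_1,\dots,x_n]$ such that for every $d\ge 0$, any $f,g\in I_{\le d}$ and any monomial $\mathbf x^{\mathbf u}$ with $[f]_{\mathbf x^{\mathbf u}}=[g]_{\mathbf x^{\mathbf u}}\ne\infty$, there is $h\in I_{\le d}$ with $[h]_{\mathbf x^{\mathbf u}}=\infty$ and $[h]_{\mathbf x^{\mathbf v}}\ge\min([f]_{\mathbf x^{\mathbf v}},[g]_{\mathbf x^{\mathbf v}})$ for all monomials $\mathbf x^{\mathbf v}$, with equality whenever $[f]_{\mathbf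 x^{\mathbf v}}\ne[g]_{\mathbf x^{\mathbf v}}$. (Equivalently, each $I_{\le d}$ is the set of vectors of a valuated matroid.) Varieties: for a polynomial $f$, $V(f)=\{\mathbf w\in\overline{\mathbb R}^n : f(\mathbf w)=\infty$ or the minimum in $f(\mathbf w)$ is achieved at least twice (i.e. by at least two terms)$\}$, and $V(I)=\bigcap_{f\in I}V(f)$. *)

theory Defs
  imports Complex_Main "HOL-Library.FuncSet" "HOL-Library.Poly_Mapping"
begin

section \<open>The tropical semiring\<close>

datatype trop = Fin real | Infty

text \<open>
  The order is the usual one with \<^term>\<open>Infty\<close> on top.  The class operations are the tropical ones:
  \<open>+\<close> is the minimum, \<open>*\<close> is real addition, the neutral element \<open>0\<close> is \<^term>\<open>Infty\<close> and
  the neutral element \<open>1\<close> is \<^term>\<open>Fin 0\<close>.  In particular \<open>0 :: trop\<close> is the greatest element.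
\<close>

instantiation trop :: linorder
begin

fun less_eq_trop :: "trop \<Rightarrow> trop \<Rightarrow> bool" where
  "less_eq_trop a Infty \<longleftrightarrow> True"
| "less_eq_trop Infty (Fin b) \<longleftrightarrow> False"
| "less_eq_trop (Fin a) (Fin b) \<longleftrightarrow> a \<le> b"

definition less_trop :: "trop \<Rightarrow> trop \<Rightarrow> bool" where
  "less_trop a b \<longleftrightarrow> a \<le> b \<and> \<not> b \<le> a"

instance
proof
  fix a b c :: trop
  show "a < b \<longleftrightarrow> a \<le> b \<and> \<not> b \<le> a" by (rule less_trop_def)
  show "a \<le> a" by (cases a) auto
  show "a \<le> c" if "a \<le> b" "b \<le> c" using that by (cases a; cases b; cases c) auto
  show "a = b" if "a \<le> b" "b \<le> a" using that by (cases a; cases b) auto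
  show "a \<le> b \<or> b \<le> a" by (cases a; cases b) auto
qed

end

instantiation trop :: comm_semiring_1
begin

definition zero_trop :: trop where "zero_trop = Infty"

definition one_trop :: trop where "one_trop = Fin 0"

definition plus_trop :: "trop \<Rightarrow> trop \<Rightarrow> trop" where "plus_trop a b = min a b"

fun times_trop :: "trop \<Rightarrow> trop \<Rightarrow> trop" where
  "times_trop (Fin a) (Fin b) = Fin (a + b)"
| "times_trop _ _ = Infty"

instance
proof
  fix a b c :: trop
  show "a + b + c = a + (b + c)" by (simp add: plus_trop_def min.assoc)
  show "a + b = b + a" by (simp add: plus_trop_def min.commute)
  show "0 + a = a" by (cases a) (auto simp: plus_trop_def zero_trop_def min_def)
  show "a * b * c = a * (b * c)" by (cases a; cases b; cases c) auto
  show "a * b = b * a" by (cases a; cases b) auto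
  show "1 * a = a" by (cases a) (auto simp: one_trop_def)
  show "(a + b) * c = a * c + b * c"
    by (cases a; cases b; cases c) (auto simp: plus_trop_def min_def)
  show "0 * a = 0" by (simp add: zero_trop_def)
  show "a * 0 = 0" by (cases a) (auto simp: zero_trop_def)
  show "(0::trop) \<noteq> 1" by (simp add: zero_trop_def one_trop_def)
qed

end

lemma sum_trop_eq_Min:
  fixes g :: "'a \<Rightarrow> trop"
  assumes "finite A" "A \<noteq> {}"
  shows "sum g A = Min (g ` A)"
  using assms by (induction rule: finite_ne_induct) (simp_all flip: plus_trop_def)


section \<open>Tropical polynomials\<close>

text \<open>
  A monomial is its exponent vector; a polynomial is a finitely supported map from monomials to
  coefficients.  Since \<open>0 = Infty\<close> in \<^typ>\<open>trop\<close>, the support consists of the monomials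
  with coefficient different from \<^term>\<open>Infty\<close>, and the semiring operations of
  \<^theory>\<open>HOL-Library.Poly_Mapping\<close> are the tropical ones on formal polynomials.
\<close>

type_synonym monom = "nat \<Rightarrow>\<^sub>0 nat"
type_synonym trop_poly = "monom \<Rightarrow>\<^sub>0 trop"

abbreviation coeff :: "trop_poly \<Rightarrow> monom \<Rightarrow> trop" where
  "coeff \<equiv> Poly_Mapping.lookup"

definition monom_degree :: "monom \<Rightarrow> nat" where
  "monom_degree u = (\<Sum>i\<in>Poly_Mapping.keys u. Poly_Mapping.lookup u i)"

text \<open>The polynomials in the \<open>n\<close> variables with indices \<open>0, \<dots>, n - 1\<close>.\<close>

definition trop_polys :: "nat \<Rightarrow> trop_poly set" where
  "trop_polys n = {f. \<forall>u\<in>Poly_Mapping.keys f. Poly_Mapping.keys u \<subseteq> {..<n}}"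

definition deg_at_most :: "trop_poly set \<Rightarrow> nat \<Rightarrow> trop_poly set" where
  "deg_at_most I d = {f \<in> I. \<forall>u\<in>Poly_Mapping.keys f. monom_degree u \<le> d}"


section \<open>Tropical ideals\<close>

definition is_ideal :: "nat \<Rightarrow> trop_poly set \<Rightarrow> bool" where
  "is_ideal n I \<longleftrightarrow>
     I \<subseteq> trop_polys n \<and> I \<noteq> {} \<and>
     (\<forall>f\<in>I. \<forall>g\<in>I. f + g \<in> I) \<and>
     (\<forall>p\<in>trop_polys n. \<forall>f\<in>I. p * f \<in> I)"

definition ideal_generated :: "nat \<Rightarrow> trop_poly set \<Rightarrow> trop_poly set" where
  "ideal_generated n S = is_ideal n hull S"

definition tropical_ideal :: "nat \<Rightarrow> trop_poly set \<Rightarrow> bool" where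
  "tropical_ideal n I \<longleftrightarrow>
     is_ideal n I \<and>
     (\<forall>d. \<forall>f\<in>deg_at_most I d. \<forall>g\<in>deg_at_most I d. \<forall>u.
        coeff f u = coeff g u \<and> coeff f u \<noteq> Infty \<longrightarrow>
        (\<exists>h\<in>deg_at_most I d.
           coeff h u = Infty \<and>
           (\<forall>v. coeff h v \<ge> min (coeff f v) (coeff g v) \<and>
                (coeff f v \<noteq> coeff g v \<longrightarrow>
                   coeff h v = min (coeff f v) (coeff g v)))))"


section \<open>Varieties\<close>

text \<open>
  Points of the \<open>n\<close>-dimensional tropical affine space are extensional functions on
  \<open>{..<n}\<close>.  The powers below are tropical powers, i.e. ordinary multiples; a variable with
  exponent 0 contributes \<open>1 = Fin 0\<close> even at a coordinate equal to \<^term>\<open>Infty\<close>.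
\<close>

definition trop_space :: "nat \<Rightarrow> (nat \<Rightarrow> trop) set" where
  "trop_space n = {..<n} \<rightarrow>\<^sub>E UNIV"

definition term_value :: "trop_poly \<Rightarrow> (nat \<Rightarrow> trop) \<Rightarrow> monom \<Rightarrow> trop" where
  "term_value f w u = coeff f u * (\<Prod>i\<in>Poly_Mapping.keys u. w i ^ Poly_Mapping.lookup u i)"

definition eval_trop :: "trop_poly \<Rightarrow> (nat \<Rightarrow> trop) \<Rightarrow> trop" where
  "eval_trop f w = (\<Sum>u\<in>Poly_Mapping.keys f. term_value f w u)"

definition hypersurface :: "nat \<Rightarrow> trop_poly \<Rightarrow> (nat \<Rightarrow> trop) set" where
  "hypersurface n f =
     {w \<in> trop_space n.
        eval_trop f w = Infty \<or>
        (\<exists>u\<in>Poly_Mapping.keys f. \<exists>v\<in>Poly_Mapping.keys f.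
           u \<noteq> v \<and> term_value f w u = eval_trop f w \<and> term_value f w v = eval_trop f w)}"

definition variety :: "nat \<Rightarrow> trop_poly set \<Rightarrow> (nat \<Rightarrow> trop) set" where
  "variety n I = (\<Inter>f\<in>I. hypersurface n f)"


lemma is_ideal_trop_polys: "is_ideal n (trop_polys n)"
proof -
  have "f + g \<in> trop_polys n" if "f \<in> trop_polys n" "g \<in> trop_polys n" for f g
    using that keys_add[of f g] by (fastforce simp: trop_polys_def)
  moreover have "p * f \<in> trop_polys n" if p: "p \<in> trop_polys n" and f: "f \<in> trop_polys n" for p f
    unfolding trop_polys_def
  proof (intro CollectI ballI)
    fix u assume "u \<in> Poly_Mapping.keys (p * f)"
    then obtain a b where "u = a + b" "a \<in> Poly_Mapping.keys p" "b \<in> Poly_Mapping.keys f"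
      using keys_mult[of p f] by blast
    then show "Poly_Mapping.keys u \<subseteq> {..<n}"
      using p f keys_add[of a b] by (fastforce simp: trop_polys_def)
  qed
  moreover have "0 \<in> trop_polys n" by (simp add: trop_polys_def)
  ultimately show ?thesis unfolding is_ideal_def by blast
qed

text \<open>The polynomial \<open>1\<close> is the constant polynomial with value \<^term>\<open>Fin 0\<close>.\<close>

lemma ideal_generated_one: "ideal_generated n {1} = trop_polys n"
proof
  have "{1} \<subseteq> trop_polys n" by (simp add: trop_polys_def)
  then show "ideal_generated n {1} \<subseteq> trop_polys n"
    unfolding ideal_generated_def by (rule hull_minimal) (rule is_ideal_trop_polys)
  show "trop_polys n \<subseteq> ideal_generated n {1}"
  proof
    fix p assume p: "p \<in> trop_polys n"
    have "p \<in> J" if "is_ideal n J" "1 \<in> J" for J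
    proof -
      from that p have "p * 1 \<in> J" unfolding is_ideal_def by blast
      then show ?thesis by simp
    qed
    then show "p \<in> ideal_generated n {1}"
      unfolding ideal_generated_def hull_def by blast
  qed
qed

end

(*
The all-infinite coordinates are chosen first: J is a minimal set of variables such that no element
of the ideal restricts to a nonzero constant on J. Elimination then shows that no element restricts
to a monomial on J, and it remains to find a root in the torus for the Laurent vectors V on Z^m,
m = |J|.

A triangular monomial change of coordinates (Noether normalization) makes the first r variables
independent modulo V, while for every j >= r there is f_j in V in the variables up to j whose terms
have distinct exponents at j. If there is no root w with w_i = 0 for i < r, then the f_j confine the
remaining coordinates to a compact box, where finitely many f in V suffice to exclude all points,
with a uniform gap. Every lattice point p of a large box, except for few p near its boundary in the
first r directions, is then the strictly minimal term of some f in V with support in the box, after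
adding a slowly varying quadratic H: its slope at p plays the role of w, and wherever p_j is close to
the boundary the slope is so steep that f_j may be used. Diagonal dominance and elimination bound the
rank of the box by the number of exceptional p, which is smaller than the number of monomials in the
r independent variables, a contradiction.
*)

theory Submission
  imports Defs "HOL-Analysis.Function_Topology" "HOL-Computational_Algebra.Polynomial"
    "HOL-Library.Function_Algebras"
begin

section \<open>Tropical vectors\<close>

definition supp :: "('a \<Rightarrow> trop) \<Rightarrow> 'a set" where
  "supp f = {u. f u \<noteq> Infty}"

text \<open>The value at \<open>Infty\<close> is a dummy: real inequalities between entries are
  stated only on supports.\<close>

fun trop_real :: "trop \<Rightarrow> real" where
  "trop_real (Fin a) = a"
| "trop_real Infty = 0"

abbreviation val :: "('a \<Rightarrow> trop) \<Rightarrow> 'a \<Rightarrow> real" where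
  "val f u \<equiv> trop_real (f u)"

text \<open>Homogeneity and the vector elimination axiom of valuated matroids, over an arbitrary,
  possibly infinite ground set.\<close>

locale tropical_vectors =
  fixes V :: "('a \<Rightarrow> trop) set"
  assumes scale: "f \<in> V \<Longrightarrow> (\<lambda>v. Fin c * f v) \<in> V"
    and eliminate: "f \<in> V \<Longrightarrow> g \<in> V \<Longrightarrow> f u = g u \<Longrightarrow> f u \<noteq> Infty \<Longrightarrow>
      \<exists>h\<in>V. h u = Infty \<and> (\<forall>v. min (f v) (g v) \<le> h v \<and> (f v \<noteq> g v \<longrightarrow> h v = min (f v) (g v)))"
begin

text \<open>Scaling \<open>g\<close> makes the two entries at \<open>u\<close> agree, so that
  \<open>u\<close> can be eliminated. The result is phrased in real numbers for Gaussian
  elimination: entries are bounded below by those of \<open>f\<close> or of the scaled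
  \<open>g\<close>, and those where \<open>f\<close> strictly wins survive unchanged.\<close>

lemma eliminate_scaled:
  assumes "f \<in> V" "g \<in> V" "u \<in> supp f" "u \<in> supp g"
  obtains h where "h \<in> V" "u \<notin> supp h" "supp h \<subseteq> supp f \<union> supp g"
    "\<And>v. v \<in> supp h \<Longrightarrow> (v \<in> supp f \<and> val f v \<le> val h v)
       \<or> (v \<in> supp g \<and> val f u - val g u + val g v \<le> val h v)"
    "\<And>v. v \<in> supp f \<Longrightarrow> (v \<in> supp g \<Longrightarrow> val f v < val f u - val g u + val g v) \<Longrightarrow>
       v \<in> supp h \<and> val h v = val f v"
proof -
  define c where "c = val f u - val g u"
  define g' where "g' = (\<lambda>v. Fin c * g v)"
  have "g' u = f u"
    using assms(3,4) by (cases "f u"; cases "g u") (auto simp: g'_def c_def supp_def)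
  then obtain h where h: "h \<in> V" "h u = Infty"
    "\<And>v. min (f v) (g' v) \<le> h v" "\<And>v. f v \<noteq> g' v \<Longrightarrow> h v = min (f v) (g' v)"
    using eliminate[of f g' u] assms scale[of g c] unfolding g'_def supp_def by auto
  show thesis
  proof (rule that[OF h(1)])
    show "u \<notin> supp h" using h(2) by (simp add: supp_def)
    show "supp h \<subseteq> supp f \<union> supp g"
    proof
      fix v assume "v \<in> supp h"
      then show "v \<in> supp f \<union> supp g"
        using h(3)[of v] by (cases "f v"; cases "g v"; cases "h v") (auto simp: supp_def g'_def)
    qed
    show "(v \<in> supp f \<and> val f v \<le> val h v)
       \<or> (v \<in> supp g \<and> val f u - val g u + val g v \<le> val h v)" if "v \<in> supp h" for v
      using that h(3)[of v] unfolding c_def[symmetric]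
      by (cases "f v"; cases "g v"; cases "h v") (auto simp: supp_def g'_def min_def split: if_splits)
    show "v \<in> supp h \<and> val h v = val f v"
      if "v \<in> supp f" "v \<in> supp g \<Longrightarrow> val f v < val f u - val g u + val g v" for v
      using that h(4)[of v] unfolding c_def[symmetric]
      by (cases "f v"; cases "g v") (auto simp: supp_def g'_def min_def split: if_splits)
  qed
qed

section \<open>Matroid rank: exchange and Gaussian elimination\<close>

text \<open>Closure in the matroid whose dependent sets are those containing the support of a
  nonzero vector; a spanning set bounds the rank of \<open>D\<close>.\<close>

definition spans :: "'a set \<Rightarrow> 'a set \<Rightarrow> bool" where
  "spans B D \<longleftrightarrow> (\<forall>p\<in>D - B. \<exists>g\<in>V. p \<in> supp g \<and> supp g \<subseteq> insert p B)"

text \<open>Steinitz exchange: \<open>g\<close> itself recovers \<open>b\<close> from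
  \<open>p\<close>. Any other vector passing through \<open>b\<close> has \<open>b\<close>
  eliminated against \<open>g\<close>; its entry at \<open>q\<close> survives because
  \<open>g\<close> has none there.\<close>

lemma spans_exchange:
  assumes "spans B D" "B \<subseteq> D" "p \<in> D - B" "g \<in> V" "p \<in> supp g" "supp g \<subseteq> insert p B"
    and b: "b \<in> B" "b \<in> supp g"
  shows "spans (insert p (B - {b})) D"
  unfolding spans_def
proof
  fix q assume q: "q \<in> D - insert p (B - {b})"
  show "\<exists>f\<in>V. q \<in> supp f \<and> supp f \<subseteq> insert q (insert p (B - {b}))"
  proof (cases "q = b")
    case True
    with assms show ?thesis by blast
  next
    case False
    with q obtain f where f: "f \<in> V" "q \<in> supp f" "supp f \<subseteq> insert q B"
      using assms(1) unfolding spans_def by blast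
    show ?thesis
    proof (cases "b \<in> supp f")
      case False
      with f show ?thesis by blast
    next
      case True
      obtain h where h: "h \<in> V" "b \<notin> supp h" "supp h \<subseteq> supp f \<union> supp g"
        "\<And>v. v \<in> supp f \<Longrightarrow> (v \<in> supp g \<Longrightarrow> val f v < val f b - val g b + val g v) \<Longrightarrow>
           v \<in> supp h \<and> val h v = val f v"
        using eliminate_scaled[OF f(1) assms(4) True b(2)] by metis
      have "q \<notin> supp g" using q False assms(6) by blast
      then have "q \<in> supp h" using h(4) f(2) by blast
      moreover have "supp h \<subseteq> insert q (insert p (B - {b}))"
        using h(2,3) f(3) assms(6) by blast
      ultimately show ?thesis using h(1) by blast
    qed
  qed
qed

text \<open>An element of \<open>T - B\<close> comes with a vector \<open>g\<close> over
  \<open>B\<close>. If \<open>supp g\<close> leaves \<open>T\<close>, it does so at some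
  \<open>b\<close> in \<open>B - T\<close>; exchanging \<open>b\<close> keeps the size of
  \<open>B\<close> while \<open>B - T\<close> shrinks.\<close>

lemma dependent_if_card_gt:
  assumes "finite D" "B \<subseteq> D" "T \<subseteq> D" "spans B D" "card B < card T"
  shows "\<exists>f\<in>V. supp f \<noteq> {} \<and> supp f \<subseteq> T"
  using assms
proof (induction "card (B - T)" arbitrary: B rule: less_induct)
  case less
  note fin = finite_subset[OF less.prems(2,1)] finite_subset[OF less.prems(3,1)]
  have "\<not> T \<subseteq> B" using less.prems(5) card_mono[OF fin(1), of T] by linarith
  then obtain p where p: "p \<in> T" "p \<notin> B" by blast
  then obtain g where g: "g \<in> V" "p \<in> supp g" "supp g \<subseteq> insert p B"
    using less.prems(3,4) unfolding spans_def by blast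
  show ?case
  proof (cases "supp g \<subseteq> T")
    case True
    with g show ?thesis by blast
  next
    case False
    then obtain b where b: "b \<in> supp g" "b \<notin> T" by blast
    then have bB: "b \<in> B" using g(3) p(1) by blast
    let ?B = "insert p (B - {b})"
    have "card ?B = card B" using bB p(2) fin(1) card_gt_0_iff[of B] by (auto simp: card_Diff_singleton)
    moreover have "?B - T = (B - T) - {b}" using p(1) by blast
    then have "card (?B - T) < card (B - T)" using bB b(2) fin(1) by (metis DiffI card_Diff1_less finite_Diff)
    moreover have "spans ?B D"
      using spans_exchange[of B D p g b] less.prems p g b bB by blast
    ultimately show ?thesis
      using less.hyps[of ?B] less.prems p(1) by auto
  qed
qed

text \<open>Gaussian elimination without pivoting: strict diagonal dominance survives each elimination step.\<close>

lemma spans_diagonally_dominant: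
  fixes H :: "'a \<Rightarrow> real"
  assumes "finite A"
    and "\<And>p. p \<in> A \<Longrightarrow> F p \<in> V \<and> p \<in> supp (F p) \<and> supp (F p) \<subseteq> D \<and>
           (\<forall>v\<in>supp (F p) - {p}. val (F p) p + H p < val (F p) v + H v)"
  shows "spans (D - A) D"
proof -
  \<comment> \<open>Dominance is relative to the potential \<open>H\<close>: \<open>p\<close> is the
    strict minimum of \<open>f + H\<close>.\<close>
  define dominant where "dominant = (\<lambda>f p. f \<in> V \<and> p \<in> supp f \<and> supp f \<subseteq> D \<and>
    (\<forall>v\<in>supp f - {p}. val f p + H p < val f v + H v))"
  \<comment> \<open>The columns in \<open>C\<close> are cleared one by one. Once \<open>C\<close> is
    all of \<open>A\<close>, each row meets \<open>A\<close> in its diagonal entry alone, which is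
    the spanning property.\<close>
  have *: "\<exists>G. \<forall>p\<in>A. dominant (G p) p \<and> supp (G p) \<inter> C \<subseteq> {p}" if "finite C" "C \<subseteq> A" for C
    using that
  proof (induction C rule: finite_induct)
    case empty
    with assms(2) show ?case by (intro exI[of _ F]) (auto simp: dominant_def)
  next
    case (insert c C)
    then obtain G where G: "\<And>p. p \<in> A \<Longrightarrow> dominant (G p) p" "\<And>p. p \<in> A \<Longrightarrow> supp (G p) \<inter> C \<subseteq> {p}"
      by auto
    have cA: "c \<in> A" using insert.prems by blast
    have "\<exists>h. dominant h p \<and> supp h \<inter> insert c C \<subseteq> {p}" if p: "p \<in> A" for p
    proof (cases "p = c \<or> c \<notin> supp (G p)")
      case True
      then show ?thesis using G p by (intro exI[of _ "G p"]) blast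
    next
      case False
      let ?f = "G p" and ?g = "G c"
      have f: "dominant ?f p" and g: "dominant ?g c" using G p cA by auto
      obtain h where h: "h \<in> V" "c \<notin> supp h" "supp h \<subseteq> supp ?f \<union> supp ?g"
        "\<And>v. v \<in> supp h \<Longrightarrow> (v \<in> supp ?f \<and> val ?f v \<le> val h v)
           \<or> (v \<in> supp ?g \<and> val ?f c - val ?g c + val ?g v \<le> val h v)"
        "\<And>v. v \<in> supp ?f \<Longrightarrow> (v \<in> supp ?g \<Longrightarrow> val ?f v < val ?f c - val ?g c + val ?g v) \<Longrightarrow>
           v \<in> supp h \<and> val h v = val ?f v"
        using eliminate_scaled[of ?f ?g c] f g False unfolding dominant_def by metis
      have fc: "val ?f p + H p < val ?f c + H c"
        using f False unfolding dominant_def by blast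
      have gv: "val ?g c + H c < val ?g v + H v" if "v \<in> supp ?g" "v \<noteq> c" for v
        using g that unfolding dominant_def by blast
      \<comment> \<open>The diagonal entry of row \<open>p\<close> is untouched: by dominance of
        both rows, the scaled row \<open>c\<close> has a larger value at \<open>p\<close>, if
        any.\<close>
      have hp: "p \<in> supp h \<and> val h p = val ?f p"
      proof (rule h(5))
        show "p \<in> supp ?f" using f unfolding dominant_def by blast
        show "val ?f p < val ?f c - val ?g c + val ?g p" if "p \<in> supp ?g"
          using gv[OF that] fc False by auto
      qed
      moreover have "val h p + H p < val h v + H v" if v: "v \<in> supp h - {p}" for v
      proof -
        from v have "v \<noteq> c" using h(2) by blast
        consider "v \<in> supp ?f" "val ?f v \<le> val h v"
          | "v \<in> supp ?g" "val ?f c - val ?g c + val ?g v \<le> val h v"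
          using h(4)[of v] v by blast
        then show ?thesis
        proof cases
          case 1
          then have "val ?f p + H p < val ?f v + H v" using f v unfolding dominant_def by blast
          with 1 hp show ?thesis by linarith
        next
          case 2
          with hp fc gv[OF 2(1) \<open>v \<noteq> c\<close>] show ?thesis by linarith
        qed
      qed
      ultimately have "dominant h p"
        using h(1,3) f g unfolding dominant_def by blast
      moreover have "supp h \<inter> insert c C \<subseteq> {p}"
        using h(2,3) G(2)[OF p] G(2)[OF cA] by blast
      ultimately show ?thesis by blast
    qed
    then show ?case by metis
  qed
  obtain G where G: "\<And>p. p \<in> A \<Longrightarrow> dominant (G p) p \<and> supp (G p) \<inter> A \<subseteq> {p}"
    using *[OF assms(1)] by blast
  show ?thesis
    unfolding spans_def
  proof
    fix p assume "p \<in> D - (D - A)"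
    then have "p \<in> A" by blast
    from G[OF this] show "\<exists>g\<in>V. p \<in> supp g \<and> supp g \<subseteq> insert p (D - A)"
      unfolding dominant_def by blast
  qed
qed

end

section \<open>Laurent vectors\<close>

text \<open>Points of Z^n are functions vanishing from index n on, so that pointwise addition
  applies and Z^r is literally contained in Z^n for r \<le> n.\<close>

definition lattice :: "nat \<Rightarrow> (nat \<Rightarrow> int) set" where
  "lattice n = {u. \<forall>i\<ge>n. u i = 0}"

definition pairing :: "nat \<Rightarrow> (nat \<Rightarrow> real) \<Rightarrow> (nat \<Rightarrow> int) \<Rightarrow> real" where
  "pairing n w u = (\<Sum>i<n. w i * of_int (u i))"

lemma pairing_diff: "pairing n w (u - v) = pairing n w u - pairing n w v"
  by (simp add: pairing_def right_diff_distrib sum_subtractf)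

text \<open>For finite nonempty support this means that the minimum is attained at least twice; a
  vector with empty support has every \<open>w\<close> as a root.\<close>

definition tropical_root :: "nat \<Rightarrow> (nat \<Rightarrow> real) \<Rightarrow> ((nat \<Rightarrow> int) \<Rightarrow> trop) \<Rightarrow> bool" where
  "tropical_root n w f \<longleftrightarrow>
     \<not> (\<exists>u\<in>supp f. \<forall>v\<in>supp f - {u}. val f u + pairing n w u < val f v + pairing n w v)"

lemma lattice_add: "u \<in> lattice n \<Longrightarrow> v \<in> lattice n \<Longrightarrow> u + v \<in> lattice n"
  and lattice_diff: "u \<in> lattice n \<Longrightarrow> v \<in> lattice n \<Longrightarrow> u - v \<in> lattice n"
  by (simp_all add: lattice_def)

definition lattice_box :: "nat \<Rightarrow> (nat \<Rightarrow> int) \<Rightarrow> (nat \<Rightarrow> int) \<Rightarrow> (nat \<Rightarrow> int) set" where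
  "lattice_box n a b = {u \<in> lattice n. \<forall>i<n. a i \<le> u i \<and> u i \<le> b i}"

lemma bij_betw_lattice_box:
  "bij_betw (\<lambda>u. restrict u {..<n}) (lattice_box n a b) (\<Pi>\<^sub>E i\<in>{..<n}. {a i..b i})"
proof (rule bij_betwI[where g = "\<lambda>u i. if i < n then u i else 0"])
  show "(\<lambda>u. restrict u {..<n}) \<in> lattice_box n a b \<rightarrow> (\<Pi>\<^sub>E i\<in>{..<n}. {a i..b i})"
    by (auto simp: lattice_box_def)
  show "(\<lambda>u i. if i < n then u i else 0) \<in> (\<Pi>\<^sub>E i\<in>{..<n}. {a i..b i}) \<rightarrow> lattice_box n a b"
    by (fastforce simp: lattice_box_def lattice_def PiE_iff)
qed (auto simp: lattice_box_def lattice_def fun_eq_iff PiE_iff extensional_def)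

lemma finite_lattice_box: "finite (lattice_box n a b)"
  using bij_betw_finite[OF bij_betw_lattice_box] by (simp add: finite_PiE)

lemma card_lattice_box: "card (lattice_box n a b) = (\<Prod>i<n. nat (b i - a i + 1))"
  using bij_betw_same_card[OF bij_betw_lattice_box[of n a b]] by (simp add: card_PiE)

text \<open>\<open>shift\<close> is multiplication by the Laurent monomial with exponent
  \<open>-v\<close>, so \<open>V\<close> imitates an ideal of Laurent polynomials in n
  variables.\<close>

locale laurent_tropical = tropical_vectors V for V :: "((nat \<Rightarrow> int) \<Rightarrow> trop) set" +
  fixes n :: nat
  assumes finite_supp: "f \<in> V \<Longrightarrow> finite (supp f)"
    and supp_lattice: "f \<in> V \<Longrightarrow> supp f \<subseteq> lattice n"
    and shift: "f \<in> V \<Longrightarrow> v \<in> lattice n \<Longrightarrow> (\<lambda>u. f (u + v)) \<in> V"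
begin

text \<open>A strict minimum with a fixed margin is an open condition on \<open>w\<close>, because
  supports are finite. A finite subcover of \<open>K\<close> involves finitely many vectors and has
  a smallest margin.\<close>

lemma finite_cover_by_gaps:
  assumes "compact K" "\<And>w. \<exists>f\<in>V. \<not> tropical_root n w f"
  obtains P \<epsilon> where "finite P" "\<epsilon> > 0" "P \<subseteq> V"
    "\<And>w. w \<in> K \<Longrightarrow> \<exists>f\<in>P. \<exists>u\<in>supp f. \<forall>v\<in>supp f - {u}.
       val f u + pairing n w u + \<epsilon> < val f v + pairing n w v"
proof -
  define U where "U = (\<lambda>(f, u, k::nat). {w::nat \<Rightarrow> real. \<forall>v\<in>supp f - {u}.
       val f u + pairing n w u + 1 / real (Suc k) < val f v + pairing n w v})"
  define C where "C = {(f, u, k::nat). f \<in> V \<and> u \<in> supp f}"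
  have "open (U c)" if "c \<in> C" for c
  proof -
    obtain f u k where c: "c = (f, u, k)" by (cases c)
    have "open {w::nat \<Rightarrow> real. val f u + pairing n w u + 1 / real (Suc k) < val f v + pairing n w v}" for v
      unfolding pairing_def by (intro open_Collect_less continuous_intros) auto
    moreover have "U c = (\<Inter>v\<in>supp f - {u}.
       {w. val f u + pairing n w u + 1 / real (Suc k) < val f v + pairing n w v})"
      by (auto simp: U_def c)
    moreover have "finite (supp f - {u})"
      using that finite_supp by (auto simp: C_def c)
    ultimately show ?thesis by (simp add: open_INT)
  qed
  moreover have "K \<subseteq> (\<Union>c\<in>C. U c)"
  proof
    fix w assume "w \<in> K"
    obtain f u where f: "f \<in> V" "u \<in> supp f"
      "\<And>v. v \<in> supp f - {u} \<Longrightarrow> val f u + pairing n w u < val f v + pairing n w v"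
      using assms(2)[of w] unfolding tropical_root_def by blast
    define S where "S = (\<lambda>v. val f v + pairing n w v - (val f u + pairing n w u)) ` (supp f - {u})"
    have S: "finite S" unfolding S_def using f(1) finite_supp by simp
    have S_pos: "0 < s" if "s \<in> S" for s
      using that f(3) unfolding S_def by fastforce
    \<comment> \<open>The inserted 1 provides a positive gap also when \<open>f\<close> is a single
      term.\<close>
    define \<delta> where "\<delta> = Min (insert 1 S)"
    have "0 < \<delta>" unfolding \<delta>_def using S S_pos by (subst Min_gr_iff) auto
    then obtain k where k: "1 / real (Suc k) < \<delta>"
      using reals_Archimedean[of \<delta>] by (auto simp: inverse_eq_divide)
    have "val f u + pairing n w u + 1 / real (Suc k) < val f v + pairing n w v" if "v \<in> supp f - {u}" for v
    proof -
      have "\<delta> \<le> val f v + pairing n w v - (val f u + pairing n w u)"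
        unfolding \<delta>_def using S that by (intro Min_le) (auto simp: S_def)
      with k show ?thesis by linarith
    qed
    then show "w \<in> (\<Union>c\<in>C. U c)"
      using f(1,2) by (intro UN_I[of "(f, u, k)"]) (auto simp: C_def U_def)
  qed
  ultimately obtain C' where C': "C' \<subseteq> C" "finite C'" "K \<subseteq> (\<Union>c\<in>C'. U c)"
    using compactE_image[OF assms(1)] by metis
  \<comment> \<open>The largest index gives the smallest margin; the inserted 0 covers an empty
    subcover.\<close>
  define k where "k = Max (insert 0 ((\<lambda>(f, u, k). k) ` C'))"
  show thesis
  proof (rule that[of "fst ` C'" "1 / real (Suc k)"])
    show "fst ` C' \<subseteq> V" using C'(1) by (auto simp: C_def)
    fix w assume "w \<in> K"
    then obtain f u l where c: "(f, u, l) \<in> C'" "w \<in> U (f, u, l)"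
      using C'(3) by auto
    have "l \<le> k" unfolding k_def using C'(2) c(1) by (intro Max_ge) force+
    then have kl: "1 / real (Suc k) \<le> 1 / real (Suc l)" by (simp add: frac_le)
    have "val f u + pairing n w u + 1 / real (Suc k) < val f v + pairing n w v" if "v \<in> supp f - {u}" for v
    proof -
      have "val f u + pairing n w u + 1 / real (Suc l) < val f v + pairing n w v"
        using c(2) that unfolding U_def by blast
      with kl show ?thesis by linarith
    qed
    moreover have "u \<in> supp f" using c(1) C'(1) by (auto simp: C_def)
    moreover have "f \<in> fst ` C'" using c(1) by (metis fst_conv imageI)
    ultimately show "\<exists>f\<in>fst ` C'. \<exists>u\<in>supp f. \<forall>v\<in>supp f - {u}.
       val f u + pairing n w u + 1 / real (Suc k) < val f v + pairing n w v"
      by blast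
  qed (use C'(2) in auto)
qed

lemma bounded_exponents:
  assumes "finite P" "P \<subseteq> V"
  obtains S :: int where "S > 0" "\<And>f u v i. f \<in> P \<Longrightarrow> u \<in> supp f \<Longrightarrow> v \<in> supp f \<Longrightarrow> \<bar>u i - v i\<bar> \<le> S"
proof -
  define E where "E = insert 1 ((\<lambda>(u, v, i). \<bar>u i - v i\<bar>) ` (\<Union>f\<in>P. supp f \<times> supp f \<times> {..<n}))"
  have fin: "finite E" unfolding E_def using assms finite_supp
    by (intro finite.insertI finite_imageI finite_UN_I finite_cartesian_product) auto
  show thesis
  proof (rule that[of "Max E"])
    have "1 \<le> Max E" using fin by (intro Max_ge) (auto simp: E_def)
    then show pos: "Max E > 0" by simp
    fix f u v i assume f: "f \<in> P" "u \<in> supp f" "v \<in> supp f"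
    show "\<bar>u i - v i\<bar> \<le> Max E"
    proof (cases "i < n")
      case True
      with f have "\<bar>u i - v i\<bar> \<in> E" unfolding E_def by (intro insertI2 image_eqI[of _ _ "(u, v, i)"]) auto
      then show ?thesis using fin by (rule Max_ge[rotated])
    next
      case False
      moreover have "u \<in> lattice n" "v \<in> lattice n" using supp_lattice f assms(2) by blast+
      ultimately have "u i = 0" "v i = 0" by (simp_all add: lattice_def)
      then show ?thesis using pos by simp
    qed
  qed
qed

end

section \<open>Estimates for slopes, the quadratic potential and boundary points\<close>

text \<open>
  The slope bounds \<open>(q - 1) q\<^sup>i\<close> grow so fast that the last coordinate outweighs
  all the previous ones.
\<close>

lemma pairing_dominated_by_last:
  fixes M :: real
  defines "q \<equiv> 3 + 2 * M"
  assumes "j < n" "0 \<le> M"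
    and w: "\<And>i. i < j \<Longrightarrow> \<bar>w i\<bar> \<le> (q - 1) * q ^ i"
    and d: "\<And>i. i < j \<Longrightarrow> \<bar>of_int (d i)\<bar> \<le> M" "\<And>i. j < i \<Longrightarrow> d i = 0"
    and j: "(q - 1) * q ^ j / 2 \<le> w j * of_int (d j)"
  shows "1 + M \<le> pairing n w d"
proof -
  have q: "1 \<le> q" using assms by simp
  have "pairing n w d = (\<Sum>i<Suc j. w i * of_int (d i))"
    unfolding pairing_def using assms(2) d(2) by (intro sum.mono_neutral_right) auto
  moreover have "\<bar>\<Sum>i<j. w i * of_int (d i)\<bar> \<le> (\<Sum>i<j. (q - 1) * q ^ i * M)"
  proof (rule order.trans[OF sum_abs], rule sum_mono)
    fix i assume "i \<in> {..<j}"
    then show "\<bar>w i * of_int (d i)\<bar> \<le> (q - 1) * q ^ i * M"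
      unfolding abs_mult using w d(1) q by (intro mult_mono) auto
  qed
  moreover have "(\<Sum>i<j. (q - 1) * q ^ i * M) = (q ^ j - 1) * M"
    unfolding power_diff_1_eq sum_distrib_left sum_distrib_right ..
  \<comment> \<open>As (q - 1) / 2 = 1 + M, coordinate \<open>j\<close> contributes at least (1 + M)
    q^j and the earlier ones at most (q^j - 1) M in absolute value, which leaves q^j + M.\<close>
  moreover have "(q - 1) * q ^ j / 2 = q ^ j + M * q ^ j" by (simp add: q_def field_simps)
  moreover have "1 \<le> q ^ j" using q by simp
  ultimately show ?thesis using j by (simp add: algebra_simps)
qed

text \<open>The slope of x - x^2 / N runs from 1 at 0 to -1 at N, and the deviation from the tangent
  is negligible over bounded distances once N is large.\<close>

lemma quadratic_expansion:
  fixes a b t N :: real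
  assumes "N \<noteq> 0"
  shows "(b - b\<^sup>2 / N) - (a - a\<^sup>2 / N) = (1 - 2 * a / N) * (b - a) - (b - a)\<^sup>2 / N"
  using assms by (simp add: field_simps power2_eq_square)

text \<open>Points within \<open>S\<close> of the boundary form a fraction of order 1 / X of an
  r-dimensional box of side \<open>X + 1\<close>, so even \<open>k\<close> times their number stays
  below the size of the box.\<close>

lemma interior_box_fills:
  fixes S :: int and r k :: nat
  assumes "0 < S" "0 < k"
  obtains X :: int where "0 \<le> X"
    "k * (nat (X + 1) ^ r - nat (X + 1 - 2 * S) ^ r) < nat (X + 1) ^ r"
proof -
  \<comment> \<open>\<open>Y\<close> is the side \<open>X + 1\<close>. Bernoulli's inequality bounds
    the boundary fraction by 2 S r / Y, and this \<open>Y\<close> makes it less than 1 / k.\<close>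
  define Y where "Y = 2 * S * int r * int k + 2 * S"
  have Y: "2 * S \<le> Y" using assms by (simp add: Y_def)
  define x where "x = - (2 * real_of_int S / real_of_int Y)"
  have Y0: "0 < Y" using Y assms by linarith
  then have "- 1 \<le> x" using Y by (simp add: x_def)
  then have "1 + real r * x \<le> (1 + x) ^ r" by (rule Bernoulli_inequality)
  then have "(1 + real r * x) * real_of_int Y ^ r \<le> ((1 + x) * real_of_int Y) ^ r"
    using Y0 by (simp add: power_mult_distrib mult_right_mono)
  also have "(1 + x) * real_of_int Y = real_of_int (Y - 2 * S)"
    using Y0 by (simp add: x_def field_simps)
  finally have "real_of_int Y ^ r - real_of_int (Y - 2 * S) ^ r \<le> - (real r * x) * real_of_int Y ^ r"
    by (simp add: algebra_simps)
  then have "real k * (real_of_int Y ^ r - real_of_int (Y - 2 * S) ^ r)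
      \<le> real k * (- (real r * x) * real_of_int Y ^ r)"
    by (rule mult_left_mono) simp
  also have "\<dots> = (real k * - (real r * x)) * real_of_int Y ^ r" by simp
  also have "\<dots> < 1 * real_of_int Y ^ r"
  proof (rule mult_strict_right_mono)
    have "real_of_int (2 * S * int r * int k) < real_of_int Y"
      using assms unfolding Y_def by (subst of_int_less_iff) linarith
    then show "real k * - (real r * x) < 1"
      using Y0 by (simp add: x_def field_simps)
  qed (use Y0 in simp)
  finally have *: "real k * (real_of_int Y ^ r - real_of_int (Y - 2 * S) ^ r) < real_of_int Y ^ r" by simp
  have le: "nat (Y - 2 * S) ^ r \<le> nat Y ^ r"
    using assms by (intro power_mono) auto
  have "real (k * (nat Y ^ r - nat (Y - 2 * S) ^ r)) < real (nat Y ^ r)"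
    using * Y Y0 le by (simp add: of_nat_diff)
  then have "k * (nat Y ^ r - nat (Y - 2 * S) ^ r) < nat Y ^ r" by (simp only: of_nat_less_iff)
  then show thesis using Y0 by (intro that[of "Y - 1"]) (auto simp: algebra_simps)
qed

section \<open>Roots of normalized families: counting in a box\<close>

context laurent_tropical
begin

text \<open>Translating \<open>f\<close> by \<open>p - u\<close> moves the term \<open>u\<close>
  onto \<open>p\<close> and every other term \<open>v\<close> to \<open>p + v - u\<close>.\<close>

lemma dominant_row:
  assumes "f \<in> V" "u \<in> supp f" "p \<in> lattice n"
    and "\<And>v. v \<in> supp f \<Longrightarrow> v \<noteq> u \<Longrightarrow> val f u + H p < val f v + H (p + v - u)"
    and "\<And>v. v \<in> supp f \<Longrightarrow> p + v - u \<in> D"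
  shows "\<exists>F. F \<in> V \<and> p \<in> supp F \<and> supp F \<subseteq> D \<and> (\<forall>v\<in>supp F - {p}. val F p + H p < val F v + H v)"
proof (intro exI conjI ballI)
  let ?F = "\<lambda>t. f (t + (u - p))"
  show "?F \<in> V"
    using assms supp_lattice by (intro shift lattice_diff) auto
  show "p \<in> supp ?F" using assms(2) by (simp add: supp_def)
  have *: "t + (u - p) \<in> supp f" "p + (t + (u - p)) - u = t" if "t \<in> supp ?F" for t
    using that by (simp_all add: supp_def)
  show "supp ?F \<subseteq> D"
  proof
    fix t assume "t \<in> supp ?F"
    from assms(5)[OF *(1)[OF this]] show "t \<in> D" unfolding *(2)[OF \<open>t \<in> supp ?F\<close>] .
  qed
  fix t assume t: "t \<in> supp ?F - {p}"
  then have "t + (u - p) \<noteq> u" by (simp add: algebra_simps)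
  with assms(4)[OF *(1)[of t]] t have "val f u + H p < val ?F t + H (p + (t + (u - p)) - u)" by blast
  then show "val ?F p + H p < val ?F t + H t" using *(2)[of t] t by simp
qed

text \<open>The two hypotheses are the halves of Noether normalization. Distinct exponents at
  \<open>j\<close> let a steep slope there single out an extreme term. Without a root, this and
  compactness give dominant rows at so many points of a box that its rank drops below the number of
  independent monomials in it.\<close>

theorem normalized_root:
  assumes "r \<le> n"
    and independent: "\<And>f. f \<in> V \<Longrightarrow> supp f \<subseteq> lattice r \<Longrightarrow> supp f = {}"
    and monic: "\<And>j. r \<le> j \<Longrightarrow> j < n \<Longrightarrow>
      \<exists>f\<in>V. supp f \<noteq> {} \<and> supp f \<subseteq> lattice (Suc j) \<and> inj_on (\<lambda>u. u j) (supp f)"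
  shows "\<exists>w. \<forall>f\<in>V. tropical_root n w f"
proof (rule ccontr)
  assume "\<not> ?thesis"
  then have no_root: "\<exists>f\<in>V. \<not> tropical_root n w f" for w by blast
  obtain g where g: "\<And>j. r \<le> j \<Longrightarrow> j < n \<Longrightarrow>
      g j \<in> V \<and> supp (g j) \<noteq> {} \<and> supp (g j) \<subseteq> lattice (Suc j) \<and> inj_on (\<lambda>u. u j) (supp (g j))"
    using monic by metis
  let ?G = "g ` {r..<n}"
  have G: "finite ?G" "?G \<subseteq> V" using g by auto
  \<comment> \<open>\<open>M\<close> bounds the differences of exponents and of coefficients within
    each \<open>g j\<close>.\<close>
  obtain M where M: "0 \<le> M"
    "\<And>j u v i. r \<le> j \<Longrightarrow> j < n \<Longrightarrow> u \<in> supp (g j) \<Longrightarrow> v \<in> supp (g j) \<Longrightarrow>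
      \<bar>real_of_int (u i - v i)\<bar> \<le> M \<and> val (g j) u - val (g j) v \<le> M"
  proof -
    obtain S where S: "S > 0"
      "\<And>f u v i. f \<in> ?G \<Longrightarrow> u \<in> supp f \<Longrightarrow> v \<in> supp f \<Longrightarrow> \<bar>u i - v i\<bar> \<le> S"
      using bounded_exponents[OF G] by blast
    define E where "E = insert (real_of_int S)
      ((\<lambda>(f, u, v). val f u - val f v) ` (SIGMA f:?G. supp f \<times> supp f))"
    have fin: "finite E" unfolding E_def using G finite_supp
      by (intro finite.insertI finite_imageI finite_SigmaI finite_cartesian_product) auto
    show thesis
    proof (rule that[of "Max E"])
      have SE: "real_of_int S \<le> Max E" using fin by (intro Max_ge) (auto simp: E_def)
      then show "0 \<le> Max E" using S(1) by linarith
      fix j u v i assume j: "r \<le> j" "j < n" "u \<in> supp (g j)" "v \<in> supp (g j)"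
      then have "val (g j) u - val (g j) v \<in> E"
        unfolding E_def by (intro insertI2 image_eqI[of _ _ "(g j, u, v)"]) auto
      then have "val (g j) u - val (g j) v \<le> Max E" using fin by (rule Max_ge[rotated])
      moreover have "\<bar>u i - v i\<bar> \<le> S" using S(2)[of "g j" u v i] j by simp
      then have "\<bar>real_of_int (u i - v i)\<bar> \<le> real_of_int S" by linarith
      ultimately show "\<bar>real_of_int (u i - v i)\<bar> \<le> Max E \<and> val (g j) u - val (g j) v \<le> Max E"
        using SE by linarith
    qed
  qed
  \<comment> \<open>The growth rate is that of \<open>pairing_dominated_by_last\<close>: a slope of
    size at least \<open>W j / 2\<close> at \<open>j\<close> outweighs slopes up to
    \<open>W i\<close> at all i < j.\<close>
  define q where "q = 3 + 2 * M"
  define W where "W = (\<lambda>i. (q - 1) * q ^ i)"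
  have W0: "0 < W i" for i using M(1) by (simp add: W_def q_def)
  \<comment> \<open>The first r coordinates of a candidate root are normalized to 0; those from n on
    are pinned to keep the product compact.\<close>
  define K where "K = (\<Pi>\<^sub>E i\<in>UNIV. if r \<le> i \<and> i < n then {- W i..W i} else {0::real})"
  have "compact K"
  proof -
    have "compactin (product_topology (\<lambda>i::nat. euclidean::real topology) UNIV) K"
      unfolding K_def by (subst compactin_PiE) auto
    then show ?thesis by (simp add: euclidean_product_topology)
  qed
  from finite_cover_by_gaps[OF this no_root] obtain P \<epsilon>\<^sub>0 where P: "finite P" "\<epsilon>\<^sub>0 > 0" "P \<subseteq> V"
    "\<And>w. w \<in> K \<Longrightarrow> \<exists>f\<in>P. \<exists>u\<in>supp f. \<forall>v\<in>supp f - {u}.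
       val f u + pairing n w u + \<epsilon>\<^sub>0 < val f v + pairing n w v" by metis
  \<comment> \<open>Below 1, the margin also fits under the surplus that
    \<open>pairing_dominated_by_last\<close> leaves beyond \<open>M\<close>.\<close>
  define \<epsilon> where "\<epsilon> = min \<epsilon>\<^sub>0 (1/2)"
  have \<epsilon>: "0 < \<epsilon>" "\<epsilon> \<le> \<epsilon>\<^sub>0" "\<epsilon> < 1" using P(2) by (auto simp: \<epsilon>_def)
  obtain S where S: "S > 0"
    "\<And>f u v i. f \<in> P \<union> ?G \<Longrightarrow> u \<in> supp f \<Longrightarrow> v \<in> supp f \<Longrightarrow> \<bar>u i - v i\<bar> \<le> S"
    using bounded_exponents[of "P \<union> ?G"] P G by blast
  define w\<^sub>0 where "w\<^sub>0 = (\<Sum>i<n. W i) * (real_of_int S)\<^sup>2"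
  \<comment> \<open>\<open>4 * S\<close> makes the slope at least half of its extreme size within
    \<open>S\<close> of either end; the second bound pushes the total quadratic error below
    \<open>\<epsilon>\<close>.\<close>
  define N where "N = max (4 * S) (\<lceil>w\<^sub>0 / \<epsilon>\<rceil> + 1)"
  have N: "4 * S \<le> N" "0 < N" using S(1) by (auto simp: N_def)
  have error: "w\<^sub>0 / of_int N < \<epsilon>"
  proof -
    have "w\<^sub>0 / \<epsilon> < of_int N" unfolding N_def by linarith
    then show ?thesis using \<epsilon>(1) N(2) by (simp add: field_simps)
  qed
  \<comment> \<open>This is the gradient of the concave potential \<open>H\<close> defined
    next.\<close>
  define slope where "slope = (\<lambda>p i. if r \<le> i \<and> i < n then W i * (1 - 2 * of_int (p i) / of_int N) else (0::real))"
  define H where "H = (\<lambda>p. \<Sum>i<n. if r \<le> i then W i * (of_int (p i) - (of_int (p i))\<^sup>2 / of_int N) else (0::real))"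
  \<comment> \<open>Within distance \<open>S\<close> of \<open>p\<close>, \<open>H\<close> falls
    less than \<open>\<epsilon>\<close> below its tangent at \<open>p\<close>.\<close>
  have H_diff: "pairing n (slope p) (p' - p) - \<epsilon> < H p' - H p" if "\<And>i. \<bar>p' i - p i\<bar> \<le> S" for p p'
  proof -
    have "pairing n (slope p) (p' - p) - (H p' - H p) \<le> (\<Sum>i<n. W i * (real_of_int S)\<^sup>2 / of_int N)"
      unfolding pairing_def H_def sum_subtractf[symmetric]
    proof (rule sum_mono)
      fix i assume i: "i \<in> {..<n}"
      have "\<bar>real_of_int (p' i - p i)\<bar> \<le> real_of_int S" using that[of i] by linarith
      then have sq: "(real_of_int (p' i) - real_of_int (p i))\<^sup>2 \<le> (real_of_int S)\<^sup>2"
        using S(1) by (intro abs_le_square_iff[THEN iffD1]) auto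
      show "slope p i * real_of_int ((p' - p) i) -
         ((if r \<le> i then W i * (of_int (p' i) - (of_int (p' i))\<^sup>2 / of_int N) else 0) -
          (if r \<le> i then W i * (of_int (p i) - (of_int (p i))\<^sup>2 / of_int N) else 0))
         \<le> W i * (real_of_int S)\<^sup>2 / of_int N"
      proof (cases "r \<le> i")
        case True
        have "slope p i * real_of_int ((p' - p) i) -
           (W i * (of_int (p' i) - (of_int (p' i))\<^sup>2 / of_int N) - W i * (of_int (p i) - (of_int (p i))\<^sup>2 / of_int N))
           = W i * ((1 - 2 * of_int (p i) / of_int N) * (of_int (p' i) - of_int (p i)) -
             ((of_int (p' i) - (of_int (p' i))\<^sup>2 / of_int N) - (of_int (p i) - (of_int (p i))\<^sup>2 / of_int N)))"
          using i True by (simp add: slope_def algebra_simps)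
        also have "\<dots> = W i * ((of_int (p' i) - of_int (p i))\<^sup>2 / of_int N)"
          using N(2) by (subst quadratic_expansion) auto
        also have "\<dots> \<le> W i * ((real_of_int S)\<^sup>2 / of_int N)"
          using sq N(2) W0[of i] by (intro mult_left_mono divide_right_mono) auto
        finally show ?thesis using True by simp
      next
        case False
        then show ?thesis using W0[of i] N(2) by (simp add: slope_def)
      qed
    qed
    also have "\<dots> = w\<^sub>0 / of_int N" by (simp add: w\<^sub>0_def sum_distrib_right sum_divide_distrib)
    finally show ?thesis using error by linarith
  qed
  \<comment> \<open>The number of points of the box \<open>D\<close> below over each choice of the
    first r coordinates.\<close>
  define k where "k = nat (N + 1) ^ (n - r)"
  have "0 < k" using N(2) by (simp add: k_def)
  with S(1) obtain X where X: "0 \<le> X" "k * (nat (X + 1) ^ r - nat (X + 1 - 2 * S) ^ r) < nat (X + 1) ^ r"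
    using interior_box_fills by blast
  \<comment> \<open>\<open>A\<close> trims \<open>D\<close> only in the first r directions, where
    the slope is 0 and cannot steer terms back into the box. \<open>T\<close> holds the monomials in
    the r independent variables.\<close>
  define D where "D = lattice_box n (\<lambda>i. 0) (\<lambda>i. if i < r then X else N)"
  define A where "A = lattice_box n (\<lambda>i. if i < r then S else 0) (\<lambda>i. if i < r then X - S else N)"
  define T where "T = lattice_box n (\<lambda>i. 0) (\<lambda>i. if i < r then X else 0)"
  have card_split: "(\<Prod>i<n. if i < r then x else y) = x ^ r * y ^ (n - r)" for x y :: nat
  proof -
    have "(\<Prod>i<n. if i < r then x else y) =
        (\<Prod>i=0..<r. if i < r then x else y) * (\<Prod>i=r..<n. if i < r then x else y)"
      unfolding lessThan_atLeast0 using assms(1) by (intro prod.atLeastLessThan_concat[symmetric]) auto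
    then show ?thesis by simp
  qed
  have "card D = (\<Prod>i<n. if i < r then nat (X + 1) else nat (N + 1))"
    unfolding D_def card_lattice_box by (rule prod.cong) auto
  moreover have "card A = (\<Prod>i<n. if i < r then nat (X + 1 - 2 * S) else nat (N + 1))"
    unfolding A_def card_lattice_box by (rule prod.cong) (auto simp: algebra_simps)
  moreover have "card T = (\<Prod>i<n. if i < r then nat (X + 1) else 1)"
    unfolding T_def card_lattice_box by (rule prod.cong) auto
  ultimately have cards: "card D = nat (X + 1) ^ r * k" "card A = nat (X + 1 - 2 * S) ^ r * k"
    "card T = nat (X + 1) ^ r"
    unfolding card_split k_def by simp_all
  have AD: "A \<subseteq> D" "T \<subseteq> D" using S(1) N(2) by (fastforce simp: A_def D_def T_def lattice_box_def)+
  \<comment> \<open>The slope at \<open>p\<close> acts as the candidate root, and the margin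
    \<open>\<epsilon>\<close> will absorb the curvature of \<open>H\<close>.\<close>
  have row: "\<exists>f\<in>V. \<exists>u\<in>supp f. (\<forall>v\<in>supp f - {u}. val f u + pairing n (slope p) u + \<epsilon> < val f v + pairing n (slope p) v) \<and>
     (\<forall>v\<in>supp f. p + v - u \<in> D \<and> (\<forall>i. \<bar>v i - u i\<bar> \<le> S))" if p: "p \<in> A" for p
  proof -
    have p_lat: "p \<in> lattice n" using p by (simp add: A_def lattice_box_def)
    have p_all: "(if i < r then S else 0) \<le> p i \<and> p i \<le> (if i < r then X - S else N)" if "i < n" for i
      using p that by (simp add: A_def lattice_box_def)
    have p_free: "S \<le> p i \<and> p i \<le> X - S" if "i < r" for i
      using p_all[of i] that assms(1) by simp
    have p_box: "0 \<le> p i \<and> p i \<le> N" if "r \<le> i" "i < n" for i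
      using p_all[of i] that by simp
    have slope_le: "\<bar>slope p i\<bar> \<le> W i" for i
    proof (cases "r \<le> i \<and> i < n")
      case True
      then have "\<bar>1 - 2 * of_int (p i) / of_int N\<bar> \<le> (1::real)"
        using p_box[of i] N(2) by (auto simp: abs_le_iff field_simps)
      then show ?thesis using W0[of i] True by (simp add: slope_def abs_mult mult_le_cancel_left1)
    next
      case False
      with W0[of i] show ?thesis by (auto simp: slope_def)
    qed
    let ?near = "\<lambda>j. r \<le> j \<and> j < n \<and> (p j < S \<or> N - S < p j)"
    show ?thesis
    \<comment> \<open>A vector from \<open>P\<close> is safe when no face in the directions from r
      on is within \<open>S\<close>; otherwise some \<open>g j\<close> is used.\<close>
    proof (cases "\<exists>j. ?near j")
      case False
      have "slope p i \<in> (if r \<le> i \<and> i < n then {- W i..W i} else {0})" for i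
        using slope_le[of i] by (cases "r \<le> i \<and> i < n") (simp add: abs_le_iff minus_le_iff, auto simp: slope_def)
      then have "slope p \<in> K" by (simp add: K_def PiE_iff)
      then obtain f u where f: "f \<in> P" "u \<in> supp f" "\<And>v. v \<in> supp f - {u} \<Longrightarrow>
          val f u + pairing n (slope p) u + \<epsilon>\<^sub>0 < val f v + pairing n (slope p) v"
        using P(4) by blast
      show ?thesis
      proof (intro bexI conjI ballI allI)
        show "f \<in> V" using f P by blast
        fix v assume v: "v \<in> supp f"
        show le: "\<bar>v i - u i\<bar> \<le> S" for i using S(2)[of f v u i] f v by blast
        have "v \<in> lattice n" "u \<in> lattice n" using supp_lattice f v P by blast+
        then have "p + v - u \<in> lattice n" using p_lat by (intro lattice_diff lattice_add)
        moreover have "0 \<le> (p + v - u) i \<and> (p + v - u) i \<le> (if i < r then X else N)" if "i < n" for i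
        proof -
          have "\<not> ?near i" using False by blast
          then show ?thesis using le[of i] p_free[of i] that by (auto simp: not_less)
        qed
        ultimately show "p + v - u \<in> D" by (auto simp: D_def lattice_box_def)
      next
        fix v assume "v \<in> supp f - {u}"
        from f(3)[OF this] show "val f u + pairing n (slope p) u + \<epsilon> < val f v + pairing n (slope p) v"
          using \<epsilon>(2) by linarith
      qed (use f in auto)
    next
      case True
      \<comment> \<open>For the first such \<open>j\<close>, earlier coordinates have room
        \<open>S\<close> and \<open>g j\<close> does not move later ones, so the choice of
        \<open>u\<close> has to keep only coordinate \<open>j\<close> inside the box.\<close>
      define j where "j = (LEAST j. ?near j)"
      have near: "?near j" unfolding j_def using True by (rule LeastI_ex)
      have first: "\<not> ?near i" if "i < j" for i using not_less_Least that unfolding j_def by blast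
      define f where "f = g j"
      have f: "f \<in> V" "supp f \<noteq> {}" "supp f \<subseteq> lattice (Suc j)" "inj_on (\<lambda>u. u j) (supp f)"
        using g near unfolding f_def by auto
      have fin: "finite ((\<lambda>u. u j) ` supp f)" "(\<lambda>u. u j) ` supp f \<noteq> {}" using f finite_supp by auto
      \<comment> \<open>Taking \<open>u\<close> lowest at \<open>j\<close> near the lower face and
        highest near the upper one makes all other terms move inwards; their distance of at least 1
        meets a slope of size at least \<open>W j / 2\<close>.\<close>
      have "\<exists>u\<in>supp f. (\<forall>v\<in>supp f. 0 \<le> p j + (v j - u j) \<and> p j + (v j - u j) \<le> N) \<and>
         (\<forall>v\<in>supp f - {u}. W j / 2 \<le> slope p j * of_int (v j - u j))"
      proof (cases "p j < S")
        case low: True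
        obtain u where u0: "u \<in> supp f" "Min ((\<lambda>u. u j) ` supp f) = u j"
          using Min_in[OF fin] by blast
        have u: "u \<in> supp f" "\<And>v. v \<in> supp f \<Longrightarrow> u j \<le> v j"
          using u0 Min_le[OF fin(1)] by fastforce+
        show ?thesis
        proof (intro bexI[OF _ u(1)] conjI ballI)
          fix v assume v: "v \<in> supp f"
          have "\<bar>v j - u j\<bar> \<le> S" using S(2)[of f v u j] v u(1) near unfolding f_def by simp
          then show "p j + (v j - u j) \<le> N" using low N by linarith
          show "0 \<le> p j + (v j - u j)" using u(2)[OF v] p_box[of j] near by auto
        next
          fix v assume v: "v \<in> supp f - {u}"
          have "v j \<noteq> u j" using f(4) v u(1) by (auto dest: inj_onD)
          then have "1 \<le> real_of_int (v j - u j)" using u(2)[of v] v by auto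
          moreover have "W j / 2 \<le> slope p j"
          proof -
            have "real_of_int (4 * p j) \<le> real_of_int N" using low N S by (subst of_int_le_iff) linarith
            then have "1/2 \<le> 1 - 2 * real_of_int (p j) / of_int N" using N(2) by (simp add: field_simps)
            then have "W j * (1/2) \<le> W j * (1 - 2 * real_of_int (p j) / of_int N)"
              using W0[of j] by (intro mult_left_mono) auto
            then show ?thesis using near by (simp add: slope_def)
          qed
          ultimately have "W j / 2 * 1 \<le> slope p j * real_of_int (v j - u j)"
            using W0[of j] by (intro mult_mono) auto
          then show "W j / 2 \<le> slope p j * real_of_int (v j - u j)" by simp
        qed
      next
        case False
        then have high: "N - S < p j" using near by blast
        obtain u where u0: "u \<in> supp f" "Max ((\<lambda>u. u j) ` supp f) = u j"
          using Max_in[OF fin] by blast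
        have u: "u \<in> supp f" "\<And>v. v \<in> supp f \<Longrightarrow> v j \<le> u j"
          using u0 Max_ge[OF fin(1)] by fastforce+
        show ?thesis
        proof (intro bexI[OF _ u(1)] conjI ballI)
          fix v assume v: "v \<in> supp f"
          have "\<bar>v j - u j\<bar> \<le> S" using S(2)[of f v u j] v u(1) near unfolding f_def by simp
          then show "0 \<le> p j + (v j - u j)" using high N S by linarith
          show "p j + (v j - u j) \<le> N" using u(2)[OF v] p_box[of j] near by auto
        next
          fix v assume v: "v \<in> supp f - {u}"
          have "v j \<noteq> u j" using f(4) v u(1) by (auto dest: inj_onD)
          then have "1 \<le> real_of_int (u j - v j)" using u(2)[of v] v by auto
          moreover have "W j / 2 \<le> - slope p j"
          proof -
            have "real_of_int (3 * N) \<le> real_of_int (4 * p j)" using high N S by (subst of_int_le_iff) linarith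
            then have "1/2 \<le> 2 * real_of_int (p j) / of_int N - 1" using N(2) by (simp add: field_simps)
            then have "W j * (1/2) \<le> W j * (2 * real_of_int (p j) / of_int N - 1)"
              using W0[of j] by (intro mult_left_mono) auto
            then show ?thesis using near by (simp add: slope_def algebra_simps)
          qed
          ultimately have "W j / 2 * 1 \<le> - slope p j * real_of_int (u j - v j)"
            using W0[of j] by (intro mult_mono) auto
          then show "W j / 2 \<le> slope p j * real_of_int (v j - u j)" by (simp add: algebra_simps)
        qed
      qed
      then obtain u where u: "u \<in> supp f"
        "\<And>v. v \<in> supp f \<Longrightarrow> 0 \<le> p j + (v j - u j) \<and> p j + (v j - u j) \<le> N"
        "\<And>v. v \<in> supp f - {u} \<Longrightarrow> W j / 2 \<le> slope p j * of_int (v j - u j)"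
        by blast
      have beyond: "(v - u) i = 0" if "v \<in> supp f" "j < i" for v i
      proof -
        have "v \<in> lattice (Suc j)" "u \<in> lattice (Suc j)" using f(3) that u(1) by blast+
        with that show ?thesis by (simp add: lattice_def)
      qed
      show ?thesis
      proof (intro bexI[OF _ f(1)] bexI[OF _ u(1)] conjI ballI allI)
        fix v assume v: "v \<in> supp f - {u}"
        have bounds: "\<bar>real_of_int (v i - u i)\<bar> \<le> M" "val f u - val f v \<le> M" for i
          using M(2)[of j] near v u(1) unfolding f_def by blast+
        \<comment> \<open>The part \<open>M\<close> pays for the difference of coefficients, and the
          remaining 1 exceeds \<open>\<epsilon>\<close>.\<close>
        have "1 + M \<le> pairing n (slope p) (v - u)"
        proof (rule pairing_dominated_by_last[where j = j])
          show "\<bar>real_of_int ((v - u) i)\<bar> \<le> M" if "i < j" for i using bounds(1)[of i] by simp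
          show "(v - u) i = 0" if "j < i" for i using beyond that v by blast
          show "\<bar>slope p i\<bar> \<le> (3 + 2 * M - 1) * (3 + 2 * M) ^ i" if "i < j" for i
            using slope_le[of i] by (simp add: W_def q_def)
          show "(3 + 2 * M - 1) * (3 + 2 * M) ^ j / 2 \<le> slope p j * real_of_int ((v - u) j)"
            using u(3)[OF v] by (simp add: W_def q_def)
        qed (use near M(1) in auto)
        then show "val f u + pairing n (slope p) u + \<epsilon> < val f v + pairing n (slope p) v"
          using bounds(2) \<epsilon>(3) unfolding pairing_diff by linarith
      next
        fix v assume v: "v \<in> supp f"
        show le: "\<bar>v i - u i\<bar> \<le> S" for i
          using S(2)[of f v u i] near v u(1) unfolding f_def by auto
        have "v \<in> lattice n" "u \<in> lattice n" using supp_lattice f(1) v u(1) by blast+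
        then have "p + v - u \<in> lattice n" using p_lat by (intro lattice_diff lattice_add)
        moreover have "0 \<le> (p + v - u) i \<and> (p + v - u) i \<le> (if i < r then X else N)" if "i < n" for i
        proof (cases i j rule: linorder_cases)
          case less
          then have "\<not> ?near i" using first by blast
          then show ?thesis using le[of i] p_free[of i] that by (auto simp: not_less)
        next
          case equal
          then show ?thesis using u(2)[OF v] near by (auto simp: algebra_simps)
        next
          case greater
          then show ?thesis using beyond[OF v greater] p_box[of i] near that by auto
        qed
        ultimately show "p + v - u \<in> D" by (auto simp: D_def lattice_box_def)
      qed
    qed
  qed
  have "\<exists>F. F \<in> V \<and> p \<in> supp F \<and> supp F \<subseteq> D \<and> (\<forall>v\<in>supp F - {p}. val F p + H p < val F v + H v)"
    if p: "p \<in> A" for p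
  proof -
    obtain f u where f: "f \<in> V" "u \<in> supp f"
      "\<And>v. v \<in> supp f - {u} \<Longrightarrow> val f u + pairing n (slope p) u + \<epsilon> < val f v + pairing n (slope p) v"
      "\<And>v. v \<in> supp f \<Longrightarrow> p + v - u \<in> D" "\<And>v i. v \<in> supp f \<Longrightarrow> \<bar>v i - u i\<bar> \<le> S"
      using row[OF p] by metis
    show ?thesis
    proof (rule dominant_row[OF f(1,2)])
      show "p \<in> lattice n" using p by (simp add: A_def lattice_box_def)
      fix v assume v: "v \<in> supp f" "v \<noteq> u"
      have "pairing n (slope p) (p + v - u - p) - \<epsilon> < H (p + v - u) - H p"
        using f(5)[OF v(1)] by (intro H_diff) simp
      then have "pairing n (slope p) v - pairing n (slope p) u - \<epsilon> < H (p + v - u) - H p"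
        by (simp add: pairing_diff[symmetric])
      with f(3)[of v] v show "val f u + H p < val f v + H (p + v - u)" by force
    qed (use f(4) in auto)
  qed
  then obtain F where F: "\<And>p. p \<in> A \<Longrightarrow> F p \<in> V \<and> p \<in> supp (F p) \<and> supp (F p) \<subseteq> D \<and>
      (\<forall>v\<in>supp (F p) - {p}. val (F p) p + H p < val (F p) v + H v)" by metis
  have fin: "finite D" "finite A" by (simp_all add: D_def A_def finite_lattice_box)
  \<comment> \<open>\<open>D - A\<close> spans \<open>D\<close> and has \<open>k\<close> points over
    each trimmed point of the r-dimensional box, hence fewer elements than \<open>T\<close>. This
    forces a nonzero vector supported in \<open>T\<close>, against independence.\<close>
  have "card (D - A) = card D - card A" using fin AD by (simp add: card_Diff_subset)
  also have "\<dots> < card T" using X(2) by (simp add: cards algebra_simps diff_mult_distrib2)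
  finally have "\<exists>f\<in>V. supp f \<noteq> {} \<and> supp f \<subseteq> T"
    by (intro dependent_if_card_gt[OF fin(1) _ AD(2) spans_diagonally_dominant[OF fin(2) F]]) auto
  moreover have "T \<subseteq> lattice r"
  proof
    fix u assume u: "u \<in> T"
    have "u i = 0" if "r \<le> i" for i
      using u that by (cases "i < n") (force simp: T_def lattice_box_def lattice_def)+
    then show "u \<in> lattice r" by (simp add: lattice_def)
  qed
  ultimately show False using independent by blast
qed

end

section \<open>Noether normalization by triangular monomial maps\<close>

text \<open>With \<open>c i = t ^ (m - i)\<close> each \<open>z\<close> gives a nonzero polynomial
  in t with constant term \<open>z m\<close>, so any integer t outside finitely many roots works.
  The coefficient 1 at \<open>z m\<close> keeps the change of coordinates unitriangular.\<close>

lemma exists_nonvanishing_functional: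
  fixes Z :: "(nat \<Rightarrow> int) set"
  assumes "finite Z" "\<And>z. z \<in> Z \<Longrightarrow> \<exists>i\<le>m. z i \<noteq> 0"
  shows "\<exists>c. \<forall>z\<in>Z. z m + (\<Sum>i<m. c i * z i) \<noteq> 0"
proof -
  define p where "p = (\<lambda>z. \<Sum>i\<le>m. monom (z i :: int) (m - i))"
  have "p z \<noteq> 0" if z: "z \<in> Z" for z
  proof -
    obtain j where j: "j \<le> m" "z j \<noteq> 0" using assms(2)[OF z] by blast
    have "Polynomial.coeff (p z) (m - j) = (\<Sum>i\<le>m. if i = j then z i else 0)"
      unfolding p_def coeff_sum coeff_monom using j(1) by (intro sum.cong) auto
    also have "\<dots> = z j" using j(1) by simp
    finally show ?thesis using j(2) by auto
  qed
  then have "finite (\<Union>z\<in>Z. {t. poly (p z) t = 0})"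
    using assms(1) poly_roots_finite by blast
  then obtain t where t: "t \<notin> (\<Union>z\<in>Z. {t. poly (p z) t = 0})"
    using ex_new_if_finite infinite_UNIV_int by blast
  have "poly (p z) t = z m + (\<Sum>i<m. t ^ (m - i) * z i)" for z
    by (simp add: p_def poly_sum poly_monom lessThan_Suc_atMost[symmetric] mult.commute)
  with t show ?thesis by (intro exI[of _ "\<lambda>i. t ^ (m - i)"]) auto
qed

text \<open>A lower unitriangular integer matrix on the first n coordinates, hence a monomial change
  of coordinates invertible over the integers.\<close>

definition shear :: "nat \<Rightarrow> (nat \<Rightarrow> nat \<Rightarrow> int) \<Rightarrow> (nat \<Rightarrow> int) \<Rightarrow> nat \<Rightarrow> int" where
  "shear n c u k = (if k < n then u k + (\<Sum>i<k. c k i * u i) else u k)"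

lemma shear_add: "shear n c (u + v) = shear n c u + shear n c v"
  by (rule ext) (simp add: shear_def distrib_left sum.distrib)

lemma shear_diff: "shear n c (u - v) = shear n c u - shear n c v"
  using shear_add[of n c "u - v" v] by (simp add: algebra_simps)

lemma shear_lattice_iff: "shear n c u \<in> lattice n \<longleftrightarrow> u \<in> lattice n"
  by (auto simp: lattice_def shear_def)

lemma shear_zero_below: "(\<And>i. i < m \<Longrightarrow> u i = 0) \<Longrightarrow> k < m \<Longrightarrow> shear n c u k = 0"
  by (simp add: shear_def)

lemma shear_eq_zero: "shear n c u = 0 \<Longrightarrow> u = 0"
proof (rule ext)
  fix k assume "shear n c u = 0"
  then have z: "shear n c u k = 0" for k by simp
  show "u k = 0 k"
  proof (induction k rule: less_induct)
    case (less k)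
    with z[of k] show ?case by (simp add: shear_def split: if_splits)
  qed
qed

lemma bij_shear: "bij (shear n c)"
proof (rule bijI)
  show "inj (shear n c)"
  proof (rule injI)
    fix u v assume "shear n c u = shear n c v"
    then have "shear n c (u - v) = 0" by (simp add: shear_diff)
    then show "u = v" using shear_eq_zero by fastforce
  qed
  \<comment> \<open>Forward substitution: the first \<open>k\<close> equations are solved, the later
    coordinates still carry the right-hand side.\<close>
  have *: "\<exists>u. (\<forall>i<k. shear n c u i = v i) \<and> (\<forall>i\<ge>k. u i = v i)" for v k
  proof (induction k)
    case (Suc k)
    then obtain u where u: "\<And>i. i < k \<Longrightarrow> shear n c u i = v i" "\<And>i. k \<le> i \<Longrightarrow> u i = v i" by blast
    define u' where "u' = u(k := if k < n then v k - (\<Sum>i<k. c k i * u i) else v k)"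
    have "shear n c u' i = shear n c u i" if "i < k" for i
      unfolding shear_def u'_def using that by (auto intro!: sum.cong)
    moreover have "shear n c u' k = v k"
      by (simp add: shear_def u'_def)
    moreover have "u' i = v i" if "Suc k \<le> i" for i
      using u(2) that by (simp add: u'_def)
    ultimately show ?case using u(1) by (intro exI[of _ u']) (auto simp: less_Suc_eq)
  qed auto
  have "\<exists>u. v = shear n c u" for v
  proof -
    obtain u where "\<And>i. i < n \<Longrightarrow> shear n c u i = v i" "\<And>i. n \<le> i \<Longrightarrow> u i = v i"
      using *[of n v] by blast
    then have "v = shear n c u" by (intro ext) (metis not_le shear_def)
    then show ?thesis by blast
  qed
  then show "surj (shear n c)" unfolding surj_def by blast
qed

text \<open>The transposed matrix acts on \<open>w\<close>; this carries a root in the new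
  coordinates back to the old ones.\<close>

lemma pairing_shear:
  "pairing n w (shear n c u) =
   pairing n (\<lambda>i. w i + (\<Sum>k<n. if i < k then w k * of_int (c k i) else 0)) u"
proof -
  have "pairing n w (shear n c u) = pairing n w u + (\<Sum>k<n. \<Sum>i<k. w k * of_int (c k i) * of_int (u i))"
    by (simp add: pairing_def shear_def distrib_left sum.distrib sum_distrib_left mult.assoc)
  also have "(\<Sum>k<n. \<Sum>i<k. w k * of_int (c k i) * of_int (u i)) =
      (\<Sum>k<n. \<Sum>i<n. if i < k then w k * of_int (c k i) * of_int (u i) else 0)"
    by (intro sum.cong refl sum.mono_neutral_cong_left) auto
  also have "\<dots> = (\<Sum>i<n. \<Sum>k<n. if i < k then w k * of_int (c k i) * of_int (u i) else 0)"
    by (rule sum.swap)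
  also have "\<dots> = (\<Sum>i<n. (\<Sum>k<n. if i < k then w k * of_int (c k i) else 0) * of_int (u i))"
    unfolding sum_distrib_right by (intro sum.cong refl) simp
  finally show ?thesis
    by (simp add: pairing_def distrib_right sum.distrib)
qed

lemma supp_comp: "supp (f \<circ> \<phi>) = \<phi> -` supp f"
  by (auto simp: supp_def)

context laurent_tropical
begin

text \<open>Starting from r = n, where the second condition is void, r is lowered as long as some
  nonzero vector involves only the first r new variables: changing the last of these makes its
  exponents distinct. At the least r no such vector is left.\<close>

lemma exists_normalizing_shear:
  assumes monomial_free: "\<And>f. f \<in> V \<Longrightarrow> \<not> is_singleton (supp f)"
  obtains r c where "r \<le> n"
    "\<And>f. f \<in> V \<Longrightarrow> shear n c ` supp f \<subseteq> lattice r \<Longrightarrow> supp f = {}"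
    "\<And>j. r \<le> j \<Longrightarrow> j < n \<Longrightarrow> \<exists>f\<in>V. supp f \<noteq> {} \<and> shear n c ` supp f \<subseteq> lattice (Suc j) \<and>
       inj_on (\<lambda>u. shear n c u j) (supp f)"
proof -
  define Q where "Q = (\<lambda>k c. \<forall>j. k \<le> j \<and> j < n \<longrightarrow> (\<exists>f\<in>V. supp f \<noteq> {} \<and>
    shear n c ` supp f \<subseteq> lattice (Suc j) \<and> inj_on (\<lambda>u. shear n c u j) (supp f)))"
  define r where "r = (LEAST k. \<exists>c. Q k c)"
  have Qn: "\<exists>c. Q n c" by (auto simp: Q_def)
  then have "\<exists>c. Q r c" unfolding r_def by (rule LeastI)
  then obtain c where c: "Q r c" by blast
  have r: "r \<le> n" unfolding r_def using Qn by (rule Least_le)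
  have least: "\<not> Q k c" if "k < r" for k c
    using that not_less_Least unfolding r_def by blast
  show thesis
  proof (rule that[OF r])
    fix f assume f: "f \<in> V" "shear n c ` supp f \<subseteq> lattice r"
    show "supp f = {}"
    proof (rule ccontr)
      assume ne: "supp f \<noteq> {}"
      show False
      proof (cases r)
        case 0
        \<comment> \<open>A nonzero vector in no variables would be a monomial.\<close>
        have "u = 0" if "u \<in> supp f" for u
        proof -
          have "shear n c u = 0" using f(2) that 0 by (auto simp: lattice_def fun_eq_iff)
          then show ?thesis by (rule shear_eq_zero)
        qed
        then have "supp f = {0}" using ne by blast
        with monomial_free[OF f(1)] show False by simp
      next
        case (Suc m)
        \<comment> \<open>The new row \<open>m\<close> must be nonzero on all differences of
          exponents of \<open>f\<close>. Such a difference cannot vanish on the first r coordinates,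
          since the shear would then send it to 0.\<close>
        define Z where "Z = (\<lambda>(u, v). u - v) ` {(u, v). u \<in> supp f \<and> v \<in> supp f \<and> u \<noteq> v}"
        have "finite {(u, v). u \<in> supp f \<and> v \<in> supp f \<and> u \<noteq> v}"
          by (rule finite_subset[of _ "supp f \<times> supp f"]) (use finite_supp[OF f(1)] in auto)
        then have Z: "finite Z" by (simp add: Z_def)
        moreover have "\<exists>i\<le>m. z i \<noteq> 0" if z: "z \<in> Z" for z
        proof (rule ccontr)
          assume "\<not> ?thesis"
          then have zero: "z i = 0" if "i < r" for i using that Suc by simp
          obtain u v where uv: "z = u - v" "u \<in> supp f" "v \<in> supp f" "u \<noteq> v" using z by (auto simp: Z_def)
          have "shear n c z \<in> lattice r" unfolding uv(1) shear_diff using f(2) uv(2,3) by (intro lattice_diff) auto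
          then have "shear n c z k = 0" for k
            using shear_zero_below[of r z k n c] zero by (cases "k < r") (auto simp: lattice_def)
          then have "shear n c z = 0" by (simp add: fun_eq_iff)
          then have "z = 0" by (rule shear_eq_zero)
          with uv(1,4) show False by simp
        qed
        ultimately obtain d where d: "\<And>z. z \<in> Z \<Longrightarrow> z m + (\<Sum>i<m. d i * z i) \<noteq> 0"
          using exists_nonvanishing_functional[of Z m] by metis
        \<comment> \<open>Only coordinate \<open>m\<close> of the shear changes, so the vectors
          already found for j > m remain valid.\<close>
        define c' where "c' = c(m := d)"
        have other: "shear n c' u k = shear n c u k" if "k \<noteq> m" for u k
          using that by (simp add: shear_def c'_def)
        have lat: "shear n c' ` A \<subseteq> lattice (Suc j) \<longleftrightarrow> shear n c ` A \<subseteq> lattice (Suc j)" if "m \<le> j" for A j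
          using that other by (auto simp: lattice_def)
        have "Q m c'" unfolding Q_def
        proof (intro allI impI)
          fix j assume j: "m \<le> j \<and> j < n"
          show "\<exists>f\<in>V. supp f \<noteq> {} \<and> shear n c' ` supp f \<subseteq> lattice (Suc j) \<and>
            inj_on (\<lambda>u. shear n c' u j) (supp f)"
          proof (cases "j = m")
            case True
            have "inj_on (\<lambda>u. shear n c' u m) (supp f)"
            proof (rule inj_onI, rule ccontr)
              fix u v assume uv: "u \<in> supp f" "v \<in> supp f" "shear n c' u m = shear n c' v m" "u \<noteq> v"
              then have "u - v \<in> Z" by (auto simp: Z_def)
              moreover have "shear n c' (u - v) m = 0" using uv(3) by (simp add: shear_diff)
              ultimately show False using d[of "u - v"] j True by (simp add: shear_def c'_def)
            qed
            then show ?thesis using f ne True lat[of j] Suc by blast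
          next
            case False
            then have "r \<le> j" "m \<le> j" using j Suc by auto
            then show ?thesis using c j lat[of j] False unfolding Q_def by (simp add: other)
          qed
        qed
        with least[of m c'] Suc show False by simp
      qed
    qed
  qed (use c in \<open>auto simp: Q_def\<close>)
qed

lemma laurent_tropical_transport:
  assumes "bij \<phi>" "\<And>u v. \<phi> (u + v) = \<phi> u + \<phi> v" "\<And>u. \<phi> u \<in> lattice n \<longleftrightarrow> u \<in> lattice n"
  shows "laurent_tropical {f. f \<circ> \<phi> \<in> V} n"
proof
  have surj: "surj \<phi>" using assms(1) by (rule bij_is_surj)
  fix f :: "(nat \<Rightarrow> int) \<Rightarrow> trop" assume f: "f \<in> {f. f \<circ> \<phi> \<in> V}"
  have supp: "supp f = \<phi> ` supp (f \<circ> \<phi>)" unfolding supp_comp using surj by (simp add: surj_image_vimage_eq)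
  show "(\<lambda>v. Fin c * f v) \<in> {f. f \<circ> \<phi> \<in> V}" for c
    using scale[of "f \<circ> \<phi>" c] f by (simp add: comp_def)
  show "finite (supp f)" unfolding supp using f finite_supp by blast
  show "supp f \<subseteq> lattice n" unfolding supp using f supp_lattice[of "f \<circ> \<phi>"] assms(3) by blast
  show "(\<lambda>u. f (u + v)) \<in> {f. f \<circ> \<phi> \<in> V}" if "v \<in> lattice n" for v
  proof -
    obtain v' where v': "v = \<phi> v'" using surj by blast
    then have "(\<lambda>u. (f \<circ> \<phi>) (u + v')) \<in> V" using shift[of "f \<circ> \<phi>" v'] f that assms(3) by simp
    then show ?thesis by (simp add: comp_def assms(2) v')
  qed
  fix g :: "(nat \<Rightarrow> int) \<Rightarrow> trop" and u assume g: "g \<in> {f. f \<circ> \<phi> \<in> V}" "f u = g u" "f u \<noteq> Infty"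
  obtain u' where u': "u = \<phi> u'" using surj by blast
  then obtain h where h: "h \<in> V" "h u' = Infty" "\<And>v. min (f (\<phi> v)) (g (\<phi> v)) \<le> h v"
    "\<And>v. f (\<phi> v) \<noteq> g (\<phi> v) \<Longrightarrow> h v = min (f (\<phi> v)) (g (\<phi> v))"
    using eliminate[of "f \<circ> \<phi>" "g \<circ> \<phi>" u'] f g by auto
  have inv: "inv \<phi> (\<phi> v) = v" "\<phi> (inv \<phi> v) = v" for v
    using assms(1) by (simp_all add: bij_is_inj surj surj_f_inv_f)
  show "\<exists>h\<in>{f. f \<circ> \<phi> \<in> V}. h u = Infty \<and>
      (\<forall>v. min (f v) (g v) \<le> h v \<and> (f v \<noteq> g v \<longrightarrow> h v = min (f v) (g v)))"
    using h(1,2) h(3)[of "inv \<phi> _"] h(4)[of "inv \<phi> _"]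
    by (intro bexI[of _ "h \<circ> inv \<phi>"]) (simp_all add: inv u' comp_def)
qed

text \<open>This is the torus case: a normalizing shear reduces it to
  \<open>normalized_root\<close>, and \<open>pairing_shear\<close> returns the root.\<close>

theorem exists_tropical_root:
  assumes monomial_free: "\<And>f. f \<in> V \<Longrightarrow> \<not> is_singleton (supp f)"
  shows "\<exists>w. \<forall>f\<in>V. tropical_root n w f"
proof -
  obtain r c where r: "r \<le> n"
    "\<And>f. f \<in> V \<Longrightarrow> shear n c ` supp f \<subseteq> lattice r \<Longrightarrow> supp f = {}"
    "\<And>j. r \<le> j \<Longrightarrow> j < n \<Longrightarrow> \<exists>f\<in>V. supp f \<noteq> {} \<and> shear n c ` supp f \<subseteq> lattice (Suc j) \<and>
       inj_on (\<lambda>u. shear n c u j) (supp f)"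
    using exists_normalizing_shear[OF monomial_free] by metis
  define \<phi> where "\<phi> = shear n c"
  have surj: "surj \<phi>" and inj: "inj \<phi>" using bij_shear by (auto simp: \<phi>_def bij_def)
  interpret T: laurent_tropical "{f. f \<circ> \<phi> \<in> V}" n
    by (rule laurent_tropical_transport) (simp_all add: \<phi>_def bij_shear shear_add shear_lattice_iff)
  have comp_inv: "f \<circ> inv \<phi> \<circ> \<phi> = f" for f :: "(nat \<Rightarrow> int) \<Rightarrow> trop"
    using inj by (simp add: comp_assoc)
  have supp_back: "supp (f \<circ> inv \<phi>) = \<phi> ` supp f" for f :: "(nat \<Rightarrow> int) \<Rightarrow> trop"
    unfolding supp_comp using bij_shear[of n c, folded \<phi>_def] by (simp add: bij_vimage_eq_inv_image bij_imp_bij_inv inv_inv_eq)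
  have "\<exists>w. \<forall>f\<in>{f. f \<circ> \<phi> \<in> V}. tropical_root n w f"
  proof (rule T.normalized_root[OF r(1)])
    fix f assume f: "f \<in> {f. f \<circ> \<phi> \<in> V}" "supp f \<subseteq> lattice r"
    have "\<phi> ` supp (f \<circ> \<phi>) = supp f" unfolding supp_comp using surj by (simp add: surj_image_vimage_eq)
    then show "supp f = {}" using r(2)[of "f \<circ> \<phi>"] f by (auto simp: \<phi>_def)
  next
    fix j assume "r \<le> j" "j < n"
    then obtain f where f: "f \<in> V" "supp f \<noteq> {}" "\<phi> ` supp f \<subseteq> lattice (Suc j)"
      "inj_on (\<lambda>u. \<phi> u j) (supp f)" using r(3) unfolding \<phi>_def by blast
    have "inj_on (\<lambda>u. u j) (\<phi> ` supp f)" using f(4) by (auto simp: inj_on_def)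
    with f show "\<exists>f\<in>{f. f \<circ> \<phi> \<in> V}. supp f \<noteq> {} \<and> supp f \<subseteq> lattice (Suc j) \<and> inj_on (\<lambda>u. u j) (supp f)"
      by (intro bexI[of _ "f \<circ> inv \<phi>"]) (simp_all add: supp_back comp_inv)
  qed
  then obtain w where w: "\<And>f. f \<circ> \<phi> \<in> V \<Longrightarrow> tropical_root n w f" by blast
  have "tropical_root n (\<lambda>i. w i + (\<Sum>k<n. if i < k then w k * of_int (c k i) else 0)) f" if "f \<in> V" for f
  proof -
    have "tropical_root n w (f \<circ> inv \<phi>)" using w[of "f \<circ> inv \<phi>"] that by (simp add: comp_inv)
    moreover have "(f \<circ> inv \<phi>) (\<phi> u) = f u" for u using inj by simp
    moreover have "\<phi> ` supp f - {\<phi> u} = \<phi> ` (supp f - {u})" for u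
      using inj by (auto dest: injD)
    ultimately show ?thesis
      unfolding tropical_root_def supp_back pairing_shear[symmetric] \<phi>_def[symmetric] by simp
  qed
  then show ?thesis by blast
qed

end

hide_const (open) Polynomial.coeff

section \<open>Tropical ideals\<close>

lemma coeff_monomial_mult:
  fixes f :: trop_poly
  shows "coeff (Poly_Mapping.single a c * f) (a + b) = c * coeff f b"
    and "(\<And>b. u \<noteq> a + b) \<Longrightarrow> coeff (Poly_Mapping.single a c * f) u = Infty"
proof -
  have "coeff (Poly_Mapping.single a c * f) v = c * (\<Sum>q. coeff f q when v = a + q)" for v
    by (simp add: lookup_mult lookup_single when_mult)
  then show "coeff (Poly_Mapping.single a c * f) (a + b) = c * coeff f b"
    and "(\<And>b. u \<noteq> a + b) \<Longrightarrow> coeff (Poly_Mapping.single a c * f) u = Infty"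
    by (simp_all flip: zero_trop_def)
qed

lemma keys_add_monom: "Poly_Mapping.keys (a + b) = Poly_Mapping.keys a \<union> Poly_Mapping.keys (b :: monom)"
  by (auto simp: in_keys_iff lookup_add)

lemma in_keys_trop_iff: "u \<in> Poly_Mapping.keys f \<longleftrightarrow> coeff f u \<noteq> Infty"
  by (simp add: in_keys_iff zero_trop_def)

text \<open>Setting the variables outside \<open>J\<close> to \<open>Infty\<close> leaves exactly
  the monomials supported in \<open>J\<close>. For such \<open>a\<close>, some \<open>g\<close> in
  \<open>I\<close> then becomes the single term \<open>a\<close>; the case a = 0 is a nonzero
  constant.\<close>

definition has_monomial_on :: "trop_poly set \<Rightarrow> nat set \<Rightarrow> monom \<Rightarrow> bool" where
  "has_monomial_on I J a \<longleftrightarrow> (\<exists>g\<in>I. coeff g a \<noteq> Infty \<and>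
     (\<forall>b. Poly_Mapping.keys b \<subseteq> J \<longrightarrow> b \<noteq> a \<longrightarrow> coeff g b = Infty))"

lemma tropical_ideal_mult:
  "tropical_ideal n I \<Longrightarrow> p \<in> trop_polys n \<Longrightarrow> f \<in> I \<Longrightarrow> p * f \<in> I"
  by (simp add: tropical_ideal_def is_ideal_def)

lemma tropical_ideal_keys:
  "tropical_ideal n I \<Longrightarrow> f \<in> I \<Longrightarrow> coeff f a \<noteq> Infty \<Longrightarrow> Poly_Mapping.keys a \<subseteq> {..<n}"
  unfolding tropical_ideal_def is_ideal_def trop_polys_def
  by (metis (no_types, lifting) in_keys_trop_iff mem_Collect_eq subsetD)

lemma single_in_trop_polys: "Poly_Mapping.keys a \<subseteq> {..<n} \<Longrightarrow> Poly_Mapping.single a c \<in> trop_polys n"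
  by (simp add: trop_polys_def)

lemma tropical_ideal_eliminate:
  assumes "tropical_ideal n I" "f \<in> I" "g \<in> I" "coeff f u = coeff g u" "coeff f u \<noteq> Infty"
  shows "\<exists>h\<in>I. coeff h u = Infty \<and> (\<forall>v. min (coeff f v) (coeff g v) \<le> coeff h v \<and>
    (coeff f v \<noteq> coeff g v \<longrightarrow> coeff h v = min (coeff f v) (coeff g v)))"
proof -
  define d where "d = Max (insert 0 (monom_degree ` (Poly_Mapping.keys f \<union> Poly_Mapping.keys g)))"
  have "monom_degree v \<le> d" if "v \<in> Poly_Mapping.keys f \<union> Poly_Mapping.keys g" for v
    unfolding d_def using that by (intro Max_ge) auto
  then have "f \<in> deg_at_most I d" "g \<in> deg_at_most I d"
    using assms(2,3) by (auto simp: deg_at_most_def)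
  then obtain h where "h \<in> deg_at_most I d" "coeff h u = Infty" "\<forall>v. min (coeff f v) (coeff g v) \<le> coeff h v \<and>
    (coeff f v \<noteq> coeff g v \<longrightarrow> coeff h v = min (coeff f v) (coeff g v))"
    using assms unfolding tropical_ideal_def by metis
  then show ?thesis by (auto simp: deg_at_most_def)
qed

text \<open>Let a = a' + e_i. Minimality of \<open>J\<close> gives \<open>f\<close> whose terms on
  \<open>J\<close> are a constant and multiples of x_i, so x^a' f has on \<open>J\<close> the term
  a' and multiples of x^a. The latter are eliminated against a \<open>g\<close> that is the monomial
  a on \<open>J\<close>, leaving a' alone; descending on the degree ends at a constant.\<close>

lemma no_monomial_if_no_constant:
  assumes I: "tropical_ideal n I" and J: "J \<subseteq> {..<n}"
    and const: "\<not> has_monomial_on I J 0" "\<And>i. i \<in> J \<Longrightarrow> has_monomial_on I (J - {i}) 0"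
  shows "Poly_Mapping.keys a \<subseteq> J \<Longrightarrow> \<not> has_monomial_on I J a"
proof (induction "\<Sum>i<n. Poly_Mapping.lookup a i" arbitrary: a rule: less_induct)
  case less
  show ?case
  proof (cases "a = 0")
    case True
    with const(1) show ?thesis by simp
  next
    case False
    then have "Poly_Mapping.keys a \<noteq> {}" by simp
    then obtain i where i: "i \<in> Poly_Mapping.keys a" by blast
    then have iJ: "i \<in> J" using less.prems by blast
    let ?e = "Poly_Mapping.single i (1::nat)"
    define a' where "a' = a - ?e"
    have a: "a = a' + ?e"
      by (rule poly_mapping_eqI) (use i in \<open>auto simp: a'_def lookup_add lookup_minus lookup_single when_def in_keys_iff\<close>)
    have a': "Poly_Mapping.keys a' \<subseteq> J" using less.prems by (auto simp: a keys_add_monom)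
    have "(\<Sum>k<n. Poly_Mapping.lookup ?e k) = 1"
      using iJ J by (auto simp: lookup_single when_def)
    then have "(\<Sum>k<n. Poly_Mapping.lookup a' k) < (\<Sum>k<n. Poly_Mapping.lookup a k)"
      unfolding a by (simp add: lookup_add sum.distrib)
    with less.hyps a' have IH: "\<not> has_monomial_on I J a'" by blast
    show ?thesis
    proof
      assume "has_monomial_on I J a"
      then obtain g where g: "g \<in> I" "coeff g a \<noteq> Infty"
        "\<And>b. Poly_Mapping.keys b \<subseteq> J \<Longrightarrow> b \<noteq> a \<Longrightarrow> coeff g b = Infty"
        unfolding has_monomial_on_def by blast
      obtain f where f: "f \<in> I" "coeff f 0 \<noteq> Infty"
        "\<And>b. Poly_Mapping.keys b \<subseteq> J - {i} \<Longrightarrow> b \<noteq> 0 \<Longrightarrow> coeff f b = Infty"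
        using const(2)[OF iJ] unfolding has_monomial_on_def by blast
      define good where "good = (\<lambda>h. h \<in> I \<and> coeff h a' \<noteq> Infty \<and>
        (\<forall>b. Poly_Mapping.keys b \<subseteq> J \<longrightarrow> coeff h b \<noteq> Infty \<longrightarrow> b = a' \<or> (\<exists>c. b = a + c)))"
      have "good (Poly_Mapping.single a' 1 * f)"
        unfolding good_def
      proof (intro conjI allI impI)
        show "Poly_Mapping.single a' 1 * f \<in> I"
          using I f(1) a' J by (intro tropical_ideal_mult single_in_trop_polys) auto
        show "coeff (Poly_Mapping.single a' 1 * f) a' \<noteq> Infty"
          using coeff_monomial_mult(1)[of a' 1 f 0] f(2) by simp
        fix b assume b: "Poly_Mapping.keys b \<subseteq> J" "coeff (Poly_Mapping.single a' 1 * f) b \<noteq> Infty"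
        then obtain c where c: "b = a' + c" using coeff_monomial_mult(2) by blast
        show "b = a' \<or> (\<exists>c. b = a + c)"
        proof (cases "c = 0")
          case False
          have "coeff f c \<noteq> Infty" using b(2) unfolding c coeff_monomial_mult(1) by simp
          moreover have "Poly_Mapping.keys c \<subseteq> J" using b(1) unfolding c keys_add_monom by blast
          ultimately have "i \<in> Poly_Mapping.keys c" using f(3)[of c] False by blast
          then have "c = ?e + (c - ?e)"
            by (intro poly_mapping_eqI) (auto simp: lookup_add lookup_minus lookup_single when_def in_keys_iff)
          then have "b = a + (c - ?e)" unfolding c a by (metis add.assoc)
          then show ?thesis by blast
        qed (simp add: c)
      qed
      \<comment> \<open>With fewest terms on \<open>J\<close>, \<open>h\<close> can have none
        besides a', as any further one could be eliminated.\<close>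
      then obtain h where h: "good h"
        and least: "\<And>h'. good h' \<Longrightarrow> card {b \<in> Poly_Mapping.keys h. Poly_Mapping.keys b \<subseteq> J}
          \<le> card {b \<in> Poly_Mapping.keys h'. Poly_Mapping.keys b \<subseteq> J}"
        using ex_has_least_nat[of good _ "\<lambda>h. card {b \<in> Poly_Mapping.keys h. Poly_Mapping.keys b \<subseteq> J}"]
        by blast
      have "coeff h b = Infty" if b: "Poly_Mapping.keys b \<subseteq> J" "b \<noteq> a'" for b
      proof (rule ccontr)
        assume hb: "coeff h b \<noteq> Infty"
        then obtain c where c: "b = a + c" using h b unfolding good_def by blast
        \<comment> \<open>The scalar makes the only term of x^c g on \<open>J\<close> agree with
          \<open>h\<close> at \<open>b\<close>.\<close>
        define r where "r = Fin (trop_real (coeff h b) - trop_real (coeff g a))"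
        define g' where "g' = Poly_Mapping.single c r * g"
        have kc: "Poly_Mapping.keys c \<subseteq> J" using b(1) unfolding c keys_add_monom by blast
        have "g' \<in> I" unfolding g'_def
          using I g(1) kc J by (intro tropical_ideal_mult single_in_trop_polys) auto
        moreover have "coeff h b = coeff g' b"
          using hb g(2) unfolding g'_def c add.commute[of a c] coeff_monomial_mult(1) r_def
          by (cases "coeff h (c + a)"; cases "coeff g a") auto
        ultimately obtain h' where h': "h' \<in> I" "coeff h' b = Infty"
          "\<And>v. min (coeff h v) (coeff g' v) \<le> coeff h' v"
          "\<And>v. coeff h v \<noteq> coeff g' v \<Longrightarrow> coeff h' v = min (coeff h v) (coeff g' v)"
          using tropical_ideal_eliminate[OF I, of h g' b] h hb unfolding good_def by metis
        have g'_Infty: "coeff g' x = Infty" if x: "Poly_Mapping.keys x \<subseteq> J" "x \<noteq> b" for x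
        proof (rule ccontr)
          assume g'x: "coeff g' x \<noteq> Infty"
          then obtain y where y: "x = c + y" using coeff_monomial_mult(2) unfolding g'_def by blast
          have "coeff g y \<noteq> Infty" using g'x unfolding g'_def y coeff_monomial_mult(1) by (cases r) auto
          moreover have "Poly_Mapping.keys y \<subseteq> J" using x(1) unfolding y keys_add_monom by blast
          ultimately have "y = a" using g(3) by blast
          with x(2) show False by (simp add: y c add.commute)
        qed
        \<comment> \<open>As \<open>g'\<close> has no other term on \<open>J\<close>, the
          elimination creates no new term there.\<close>
        have sub: "coeff h x \<noteq> Infty \<and> x \<noteq> b" if "Poly_Mapping.keys x \<subseteq> J" "coeff h' x \<noteq> Infty" for x
        proof -
          have "x \<noteq> b" using that(2) h'(2) by metis
          then have "coeff g' x = Infty" using g'_Infty that(1) by blast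
          then show ?thesis using h'(3)[of x] that(2) \<open>x \<noteq> b\<close> by (cases "coeff h' x") auto
        qed
        have "coeff h' a' \<noteq> Infty"
          using h'(4)[of a'] g'_Infty[OF a'] b(2) h unfolding good_def by (cases "coeff h a'") (auto simp: min_def)
        then have "good h'" using h'(1) h sub unfolding good_def by blast
        moreover have "{x \<in> Poly_Mapping.keys h'. Poly_Mapping.keys x \<subseteq> J}
            \<subseteq> {x \<in> Poly_Mapping.keys h. Poly_Mapping.keys x \<subseteq> J} - {b}"
          using sub by (auto simp: in_keys_trop_iff)
        then have "card {x \<in> Poly_Mapping.keys h'. Poly_Mapping.keys x \<subseteq> J}
            \<le> card ({x \<in> Poly_Mapping.keys h. Poly_Mapping.keys x \<subseteq> J} - {b})"
          by (intro card_mono) auto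
        moreover have "\<dots> < card {x \<in> Poly_Mapping.keys h. Poly_Mapping.keys x \<subseteq> J}"
          using b(1) hb[folded in_keys_trop_iff] by (intro card_Diff1_less) auto
        ultimately show False using least[of h'] by linarith
      qed
      then have "has_monomial_on I J a'"
        using h unfolding good_def has_monomial_on_def by blast
      with IH show False by blast
    qed
  qed
qed

lemma one_in_ideal_if_constant:
  assumes I: "tropical_ideal n I" and "has_monomial_on I {..<n} 0"
  shows "I = ideal_generated n {1}"
proof -
  obtain g where g: "g \<in> I" "coeff g 0 \<noteq> Infty"
    "\<And>b. Poly_Mapping.keys b \<subseteq> {..<n} \<Longrightarrow> b \<noteq> 0 \<Longrightarrow> coeff g b = Infty"
    using assms(2) unfolding has_monomial_on_def by blast
  then obtain c where c: "coeff g 0 = Fin c" by (cases "coeff g 0") auto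
  have "Poly_Mapping.single 0 (Fin (- c)) * g = 1"
  proof (rule poly_mapping_eqI)
    fix b
    have "coeff g b = Infty" if "b \<noteq> 0"
      using g(3)[of b] tropical_ideal_keys[OF I g(1), of b] that by blast
    then show "coeff (Poly_Mapping.single 0 (Fin (- c)) * g) b = coeff 1 b"
      using coeff_monomial_mult(1)[of 0 "Fin (- c)" g b] c
      by (auto simp: lookup_one when_def zero_trop_def one_trop_def)
  qed
  then have "1 \<in> I"
    using tropical_ideal_mult[OF I single_in_trop_polys g(1), of 0 "Fin (- c)"] by simp
  then have "trop_polys n \<subseteq> I" using tropical_ideal_mult[OF I, of _ 1] by auto
  then show ?thesis
    using I by (auto simp: ideal_generated_one tropical_ideal_def is_ideal_def)
qed

section \<open>Strata of the tropical affine space\<close>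

text \<open>The points whose finite coordinates are exactly those in \<open>J\<close> form a torus
  of dimension m, and \<open>\<sigma>\<close> numbers its coordinates.\<close>

locale coordinate_stratum =
  fixes n :: nat and I :: "trop_poly set" and J :: "nat set" and m :: nat and \<sigma> :: "nat \<Rightarrow> nat"
  assumes ideal: "tropical_ideal n I"
    and J: "J \<subseteq> {..<n}"
    and \<sigma>: "bij_betw \<sigma> {..<m} J"
begin

definition exponent :: "monom \<Rightarrow> nat \<Rightarrow> int" where
  "exponent a = (\<lambda>i. if i < m then int (Poly_Mapping.lookup a (\<sigma> i)) else 0)"

lemma exponent_add: "exponent (a + b) = exponent a + exponent b"
  by (auto simp: exponent_def lookup_add fun_eq_iff)

lemma exponent_lattice: "exponent a \<in> lattice m"
  by (simp add: exponent_def lattice_def)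

lemma \<sigma>_mem: "i < m \<Longrightarrow> \<sigma> i \<in> J"
  using \<sigma> by (auto simp: bij_betw_def)

lemma exponent_inj:
  assumes "exponent a = exponent b" "Poly_Mapping.keys a \<subseteq> J" "Poly_Mapping.keys b \<subseteq> J"
  shows "a = b"
proof (rule poly_mapping_eqI)
  fix k
  show "Poly_Mapping.lookup a k = Poly_Mapping.lookup b k"
  proof (cases "k \<in> J")
    case True
    then obtain i where i: "i < m" "k = \<sigma> i" using \<sigma> by (auto simp: bij_betw_def)
    from assms(1) have "exponent a i = exponent b i" by simp
    with i show ?thesis by (simp add: exponent_def)
  next
    case False
    then have "k \<notin> Poly_Mapping.keys a" "k \<notin> Poly_Mapping.keys b" using assms(2,3) by blast+
    then show ?thesis by (simp add: in_keys_iff)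
  qed
qed

lemma exponent_surj:
  assumes "u \<in> lattice m" "\<And>i. 0 \<le> u i"
  obtains a where "Poly_Mapping.keys a \<subseteq> J" "exponent a = u"
proof -
  define a where "a = (\<Sum>i<m. Poly_Mapping.single (\<sigma> i) (nat (u i)))"
  have l: "Poly_Mapping.lookup a k = (\<Sum>i<m. if \<sigma> i = k then nat (u i) else 0)" for k
    by (simp add: a_def lookup_sum lookup_single when_def)
  have \<sigma>_eq: "\<sigma> i = \<sigma> j \<longleftrightarrow> i = j" if "i < m" "j < m" for i j
    using \<sigma> that by (auto simp: bij_betw_def inj_on_def)
  show thesis
  proof (rule that)
    show "Poly_Mapping.keys a \<subseteq> J"
    proof (rule subsetI, rule ccontr)
      fix k assume "k \<in> Poly_Mapping.keys a" "k \<notin> J"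
      then have "\<sigma> i \<noteq> k" if "i < m" for i using \<sigma>_mem[OF that] by auto
      then have "Poly_Mapping.lookup a k = 0" unfolding l by (intro sum.neutral) auto
      with \<open>k \<in> Poly_Mapping.keys a\<close> show False by (simp add: in_keys_iff)
    qed
    have "Poly_Mapping.lookup a (\<sigma> j) = nat (u j)" if "j < m" for j
    proof -
      have "Poly_Mapping.lookup a (\<sigma> j) = (\<Sum>i<m. if i = j then nat (u i) else 0)"
        unfolding l using that by (intro sum.cong) (auto simp: \<sigma>_eq)
      then show ?thesis using that by simp
    qed
    then show "exponent a = u"
      using assms by (auto simp: exponent_def lattice_def fun_eq_iff)
  qed
qed

text \<open>\<open>f\<close> is the Laurent vector of \<open>g\<close> restricted to the variables in \<open>J\<close>, multiplied by the monomial \<open>v\<close>.\<close>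

definition represents :: "trop_poly \<Rightarrow> (nat \<Rightarrow> int) \<Rightarrow> ((nat \<Rightarrow> int) \<Rightarrow> trop) \<Rightarrow> bool" where
  "represents g v f \<longleftrightarrow>
     (\<forall>a. Poly_Mapping.keys a \<subseteq> J \<longrightarrow> f (exponent a + v) = coeff g a) \<and>
     (\<forall>u\<in>supp f. \<exists>a. Poly_Mapping.keys a \<subseteq> J \<and> u = exponent a + v)"

definition laurent_vectors :: "((nat \<Rightarrow> int) \<Rightarrow> trop) set" where
  "laurent_vectors = {f. \<exists>g\<in>I. \<exists>v\<in>lattice m. represents g v f}"

lemma exists_represented: "\<exists>f. represents g v f"
proof -
  define f where "f = (\<lambda>u. if \<exists>a. Poly_Mapping.keys a \<subseteq> J \<and> u = exponent a + v
    then coeff g (THE a. Poly_Mapping.keys a \<subseteq> J \<and> u = exponent a + v) else Infty)"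
  have "f (exponent a + v) = coeff g a" if "Poly_Mapping.keys a \<subseteq> J" for a
  proof -
    have "(THE b. Poly_Mapping.keys b \<subseteq> J \<and> exponent a + v = exponent b + v) = a"
      using that by (intro the_equality) (auto intro: exponent_inj)
    then show ?thesis using that by (auto simp: f_def)
  qed
  moreover have "\<exists>a. Poly_Mapping.keys a \<subseteq> J \<and> u = exponent a + v" if "u \<in> supp f" for u
    using that by (auto simp: supp_def f_def split: if_splits)
  ultimately show ?thesis unfolding represents_def by blast
qed

text \<open>Part of the Laurent shift is absorbed into the polynomial as an honest monomial; this
  brings two vectors to a common shift.\<close>

lemma represents_rebase:
  assumes f: "represents g v f" and b: "Poly_Mapping.keys b \<subseteq> J" and v: "v = exponent b + v'"
  shows "represents (Poly_Mapping.single b 1 * g) v' f"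
  unfolding represents_def
proof (intro conjI allI impI ballI)
  have v_eq: "exponent a + v = exponent (b + a) + v'" for a
    by (simp add: v exponent_add ac_simps)
  fix a :: monom assume a: "Poly_Mapping.keys a \<subseteq> J"
  show "f (exponent a + v') = coeff (Poly_Mapping.single b 1 * g) a"
  proof (cases "\<exists>c. a = b + c")
    case True
    then obtain c where c: "a = b + c" by blast
    then have "Poly_Mapping.keys c \<subseteq> J" using a by (simp add: keys_add_monom)
    then have "f (exponent c + v) = coeff g c" using f by (simp add: represents_def)
    then show ?thesis unfolding c coeff_monomial_mult(1) v_eq by simp
  next
    case False
    have "f (exponent a + v') = Infty"
    proof (rule ccontr)
      assume "f (exponent a + v') \<noteq> Infty"
      then obtain c where c: "Poly_Mapping.keys c \<subseteq> J" "exponent a + v' = exponent c + v"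
        using f unfolding represents_def supp_def by blast
      then have "a = b + c"
        using a b v_eq[of c] by (intro exponent_inj) (auto simp: keys_add_monom)
      with False show False by blast
    qed
    then show ?thesis using False coeff_monomial_mult(2)[of a b 1 g] by simp
  qed
next
  fix u assume "u \<in> supp f"
  then obtain a where a: "Poly_Mapping.keys a \<subseteq> J" "u = exponent a + v"
    using f unfolding represents_def by blast
  then show "\<exists>a. Poly_Mapping.keys a \<subseteq> J \<and> u = exponent a + v'"
    using b by (intro exI[of _ "b + a"]) (auto simp: keys_add_monom v exponent_add ac_simps)
qed

sublocale laurent_tropical laurent_vectors m
proof
  fix f assume "f \<in> laurent_vectors"
  then obtain g v where g: "g \<in> I" "v \<in> lattice m" "represents g v f"
    by (auto simp: laurent_vectors_def)
  have val: "f (exponent a + v) = coeff g a" if "Poly_Mapping.keys a \<subseteq> J" for a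
    using g(3) that by (simp add: represents_def)
  have supp: "\<exists>a. Poly_Mapping.keys a \<subseteq> J \<and> u = exponent a + v" if "u \<in> supp f" for u
    using g(3) that by (simp add: represents_def)
  show "supp f \<subseteq> lattice m"
    using supp g(2) exponent_lattice by (metis lattice_add subsetI)
  have "supp f \<subseteq> (\<lambda>a. exponent a + v) ` Poly_Mapping.keys g"
  proof
    fix u assume u: "u \<in> supp f"
    then obtain a where a: "Poly_Mapping.keys a \<subseteq> J" "u = exponent a + v" using supp by blast
    then have "a \<in> Poly_Mapping.keys g"
      using u val[OF a(1)] by (simp add: in_keys_trop_iff supp_def)
    then show "u \<in> (\<lambda>a. exponent a + v) ` Poly_Mapping.keys g" using a(2) by blast
  qed
  then show "finite (supp f)" by (rule finite_subset) simp
  show "(\<lambda>u. Fin c * f u) \<in> laurent_vectors" for c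
  proof -
    have "Poly_Mapping.single 0 (Fin c) * g \<in> I"
      using ideal g(1) by (intro tropical_ideal_mult single_in_trop_polys) auto
    moreover have "supp (\<lambda>u. Fin c * f u) \<subseteq> supp f" by (auto simp: supp_def)
    then have "represents (Poly_Mapping.single 0 (Fin c) * g) v (\<lambda>u. Fin c * f u)"
      using val supp coeff_monomial_mult(1)[of 0 "Fin c" g] by (auto simp: represents_def)
    ultimately show ?thesis using g(2) by (auto simp: laurent_vectors_def)
  qed
  show "(\<lambda>u. f (u + t)) \<in> laurent_vectors" if "t \<in> lattice m" for t
  proof -
    have "represents g (v - t) (\<lambda>u. f (u + t))"
      unfolding represents_def
    proof (intro conjI allI impI ballI)
      fix a :: monom assume "Poly_Mapping.keys a \<subseteq> J"
      from val[OF this] show "f (exponent a + (v - t) + t) = coeff g a" by (simp add: add.assoc)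
    next
      fix u assume "u \<in> supp (\<lambda>u. f (u + t))"
      then have "u + t \<in> supp f" by (simp add: supp_def)
      from supp[OF this] show "\<exists>a. Poly_Mapping.keys a \<subseteq> J \<and> u = exponent a + (v - t)"
        by (metis add_diff_cancel_right' add_diff_eq)
    qed
    moreover have "v - t \<in> lattice m" using g(2) that by (rule lattice_diff)
    ultimately show ?thesis using g(1) by (auto simp: laurent_vectors_def)
  qed
  fix f' u assume "f' \<in> laurent_vectors" and eq: "f u = f' u" "f u \<noteq> Infty"
  then obtain g' v' where g': "g' \<in> I" "v' \<in> lattice m" "represents g' v' f'"
    by (auto simp: laurent_vectors_def)
  \<comment> \<open>The componentwise minimum is a common shift from which both \<open>v\<close> and
    \<open>v'\<close> are reached by monomials with nonnegative exponents, so elimination in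
    \<open>I\<close> applies.\<close>
  define t where "t = (\<lambda>i. min (v i) (v' i))"
  have t: "t \<in> lattice m" using g(2) g'(2) by (simp add: t_def lattice_def)
  obtain b where b: "Poly_Mapping.keys b \<subseteq> J" "exponent b = v - t"
    using exponent_surj[of "v - t"] g(2) t lattice_diff by (auto simp: t_def)
  obtain b' where b': "Poly_Mapping.keys b' \<subseteq> J" "exponent b' = v' - t"
    using exponent_surj[of "v' - t"] g'(2) t lattice_diff by (auto simp: t_def)
  let ?p = "Poly_Mapping.single b 1 * g" and ?p' = "Poly_Mapping.single b' 1 * g'"
  have p: "?p \<in> I" "?p' \<in> I"
    using ideal g(1) g'(1) b(1) b'(1) J by (auto intro!: tropical_ideal_mult single_in_trop_polys)
  have rep: "represents ?p t f" "represents ?p' t f'"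
    using b b' by (auto intro!: represents_rebase[OF g(3)] represents_rebase[OF g'(3)])
  obtain a where a: "Poly_Mapping.keys a \<subseteq> J" "u = exponent a + t"
    using rep(1) eq(2) unfolding represents_def supp_def by blast
  then have "coeff ?p a = coeff ?p' a" "coeff ?p a \<noteq> Infty"
    using rep eq unfolding represents_def by metis+
  then obtain q where q: "q \<in> I" "coeff q a = Infty"
    "\<And>c. min (coeff ?p c) (coeff ?p' c) \<le> coeff q c"
    "\<And>c. coeff ?p c \<noteq> coeff ?p' c \<Longrightarrow> coeff q c = min (coeff ?p c) (coeff ?p' c)"
    using tropical_ideal_eliminate[OF ideal p] by metis
  obtain h where h: "represents q t h" using exists_represented by blast
  show "\<exists>h\<in>laurent_vectors. h u = Infty \<and>
    (\<forall>v. min (f v) (f' v) \<le> h v \<and> (f v \<noteq> f' v \<longrightarrow> h v = min (f v) (f' v)))"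
  proof (intro bexI conjI allI)
    show "h \<in> laurent_vectors" using h q(1) t by (auto simp: laurent_vectors_def)
    show "h u = Infty" using h a q(2) by (simp add: represents_def)
    fix x
    have "min (f x) (f' x) \<le> h x \<and> (f x \<noteq> f' x \<longrightarrow> h x = min (f x) (f' x))"
    proof (cases "\<exists>c. Poly_Mapping.keys c \<subseteq> J \<and> x = exponent c + t")
      case True
      then obtain c where c: "Poly_Mapping.keys c \<subseteq> J" "x = exponent c + t" by blast
      then have "f x = coeff ?p c" "f' x = coeff ?p' c" "h x = coeff q c"
        using rep h by (simp_all add: represents_def)
      with q(3,4)[of c] show ?thesis by simp
    next
      case False
      then have "f x = Infty" "f' x = Infty" "h x = Infty"
        using rep h unfolding represents_def supp_def by blast+
      then show ?thesis by simp
    qed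
    then show "min (f x) (f' x) \<le> h x" "f x \<noteq> f' x \<longrightarrow> h x = min (f x) (f' x)" by blast+
  qed
qed

section \<open>From roots in the torus to points of the variety\<close>

definition stratum_point :: "(nat \<Rightarrow> real) \<Rightarrow> nat \<Rightarrow> trop" where
  "stratum_point w = (\<lambda>i\<in>{..<n}. if i \<in> J then Fin (w (inv_into {..<m} \<sigma> i)) else Infty)"

lemma Fin_power: "Fin r ^ k = Fin (real k * r)"
  by (induction k) (auto simp: one_trop_def algebra_simps)

lemma prod_Fin: "(\<Prod>i\<in>A. Fin (r i)) = Fin (\<Sum>i\<in>A. r i)"
  by (induction A rule: infinite_finite_induct) (auto simp: one_trop_def)

lemma term_value_stratum_point:
  assumes "Poly_Mapping.keys a \<subseteq> {..<n}"
  shows "term_value f (stratum_point w) a =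
    (if Poly_Mapping.keys a \<subseteq> J then coeff f a * Fin (pairing m w (exponent a)) else Infty)"
proof (cases "Poly_Mapping.keys a \<subseteq> J")
  case True
  let ?\<tau> = "inv_into {..<m} \<sigma>"
  have "(\<Prod>i\<in>Poly_Mapping.keys a. stratum_point w i ^ Poly_Mapping.lookup a i) =
      (\<Prod>i\<in>Poly_Mapping.keys a. Fin (real (Poly_Mapping.lookup a i) * w (?\<tau> i)))"
    using True assms by (intro prod.cong refl) (auto simp: stratum_point_def Fin_power)
  also have "\<dots> = Fin (\<Sum>i\<in>Poly_Mapping.keys a. real (Poly_Mapping.lookup a i) * w (?\<tau> i))"
    by (rule prod_Fin)
  also have "(\<Sum>i\<in>Poly_Mapping.keys a. real (Poly_Mapping.lookup a i) * w (?\<tau> i)) =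
      (\<Sum>i\<in>J. real (Poly_Mapping.lookup a i) * w (?\<tau> i))"
    using True J by (intro sum.mono_neutral_left) (auto simp: in_keys_iff intro: finite_subset)
  also have "\<dots> = (\<Sum>i<m. real (Poly_Mapping.lookup a (\<sigma> i)) * w (?\<tau> (\<sigma> i)))"
    by (rule sum.reindex_bij_betw[OF \<sigma>, symmetric])
  also have "\<dots> = pairing m w (exponent a)"
    unfolding pairing_def using \<sigma>
    by (intro sum.cong refl) (auto simp: exponent_def bij_betw_def inv_into_f_f)
  finally show ?thesis using True by (simp add: term_value_def)
next
  case False
  then obtain i where i: "i \<in> Poly_Mapping.keys a" "i \<notin> J" by blast
  then have "stratum_point w i = 0"
    using assms by (auto simp: stratum_point_def zero_trop_def)
  then have "stratum_point w i ^ Poly_Mapping.lookup a i = 0"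
    using i(1) by (simp add: in_keys_iff zero_power)
  with i(1) have "(\<Prod>i\<in>Poly_Mapping.keys a. stratum_point w i ^ Poly_Mapping.lookup a i) = 0"
    by (intro prod_zero) auto
  then show ?thesis using False by (simp add: term_value_def zero_trop_def)
qed

text \<open>Monomial-freeness on \<open>J\<close> passes to the Laurent vectors, so the torus case
  yields a common root, which is completed by \<open>Infty\<close> outside \<open>J\<close>.\<close>

lemma exists_point_in_variety:
  assumes "\<And>a. Poly_Mapping.keys a \<subseteq> J \<Longrightarrow> \<not> has_monomial_on I J a"
  shows "variety n I \<noteq> {}"
proof -
  have "\<not> is_singleton (supp f)" if "f \<in> laurent_vectors" for f
  proof
    assume "is_singleton (supp f)"
    then obtain u where u: "supp f = {u}" by (auto simp: is_singleton_def)
    obtain g v where g: "g \<in> I" "represents g v f" using \<open>f \<in> laurent_vectors\<close> by (auto simp: laurent_vectors_def)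
    then obtain a where a: "Poly_Mapping.keys a \<subseteq> J" "u = exponent a + v"
      using u unfolding represents_def by blast
    have val: "f (exponent b + v) = coeff g b" if "Poly_Mapping.keys b \<subseteq> J" for b
      using g(2) that by (simp add: represents_def)
    have "coeff g b = Infty" if b: "Poly_Mapping.keys b \<subseteq> J" "b \<noteq> a" for b
    proof -
      have "exponent b + v \<noteq> u" using exponent_inj[of b a] a b by auto
      then have "exponent b + v \<notin> supp f" using u by blast
      then show ?thesis using val[OF b(1)] by (simp add: supp_def)
    qed
    moreover have "u \<in> supp f" using u by simp
    then have "coeff g a \<noteq> Infty" using val[OF a(1)] a(2) by (simp add: supp_def)
    ultimately have "has_monomial_on I J a" using g(1) unfolding has_monomial_on_def by blast
    with assms a(1) show False by blast
  qed
  from exists_tropical_root[OF this] obtain w where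
    w: "\<And>f. f \<in> laurent_vectors \<Longrightarrow> tropical_root m w f" by blast
  let ?x = "stratum_point w"
  have "?x \<in> hypersurface n f" if f: "f \<in> I" for f
  proof -
    \<comment> \<open>These are the terms of \<open>f\<close> that are finite at the point; if there
      are none, the value is \<open>Infty\<close>.\<close>
    define K where "K = {a \<in> Poly_Mapping.keys f. Poly_Mapping.keys a \<subseteq> J}"
    have fin: "finite K" by (simp add: K_def)
    have tv: "term_value f ?x a = (if a \<in> K then Fin (trop_real (coeff f a) + pairing m w (exponent a)) else Infty)"
      if "a \<in> Poly_Mapping.keys f" for a
    proof -
      have "Poly_Mapping.keys a \<subseteq> {..<n}"
        using tropical_ideal_keys[OF ideal f] that by (simp add: in_keys_trop_iff)
      from term_value_stratum_point[OF this, of f w] show ?thesis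
        using that by (cases "coeff f a") (auto simp: K_def in_keys_trop_iff)
    qed
    have "?x \<in> trop_space n" by (simp add: trop_space_def stratum_point_def)
    moreover have "eval_trop f ?x = Infty \<or> (\<exists>u\<in>Poly_Mapping.keys f. \<exists>v\<in>Poly_Mapping.keys f.
        u \<noteq> v \<and> term_value f ?x u = eval_trop f ?x \<and> term_value f ?x v = eval_trop f ?x)"
    proof (cases "K = {}")
      case True
      then have "eval_trop f ?x = 0" unfolding eval_trop_def
        by (intro sum.neutral) (simp add: tv zero_trop_def)
      then show ?thesis by (simp add: zero_trop_def)
    next
      case False
      define \<phi> where "\<phi> = (\<lambda>a. trop_real (coeff f a) + pairing m w (exponent a))"
      obtain a where a: "a \<in> K" "\<And>b. b \<in> K \<Longrightarrow> \<phi> a \<le> \<phi> b"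
        using ex_min_if_finite[of "\<phi> ` K"] fin False by (metis (no_types, lifting) finite_imageI image_iff image_is_empty not_le)
      \<comment> \<open>The Laurent vector of \<open>f\<close> with shift 0 has exactly the terms in
        \<open>K\<close>; its root \<open>w\<close> supplies a second minimal term.\<close>
      obtain F where F: "represents f 0 F" using exists_represented by blast
      have "0 \<in> lattice m" by (simp add: lattice_def)
      then have "tropical_root m w F" using w F f by (auto simp: laurent_vectors_def)
      have FK: "F (exponent b) = coeff f b" if "b \<in> K" for b
        using F that by (simp add: represents_def K_def)
      have supp_F: "supp F = exponent ` K"
      proof
        show "supp F \<subseteq> exponent ` K"
        proof
          fix u assume u: "u \<in> supp F"
          then obtain b where b: "Poly_Mapping.keys b \<subseteq> J" "u = exponent b"
            using F unfolding represents_def by auto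
          then have "F u = coeff f b" using F by (simp add: represents_def)
          with u b show "u \<in> exponent ` K" by (auto simp: K_def in_keys_trop_iff supp_def)
        qed
        show "exponent ` K \<subseteq> supp F" using FK by (auto simp: K_def in_keys_trop_iff supp_def)
      qed
      from \<open>tropical_root m w F\<close> a(1) obtain v where v: "v \<in> supp F - {exponent a}"
        "\<not> val F (exponent a) + pairing m w (exponent a) < val F v + pairing m w v"
        unfolding tropical_root_def supp_F by blast
      then obtain b where b: "b \<in> K" "b \<noteq> a" "v = exponent b" unfolding supp_F by blast
      have "\<phi> b \<le> \<phi> a" using v(2) FK a(1) b by (simp add: \<phi>_def)
      then have eq: "\<phi> b = \<phi> a" using a(2)[OF b(1)] by simp
      have keys: "a \<in> Poly_Mapping.keys f" "b \<in> Poly_Mapping.keys f" using a(1) b(1) by (auto simp: K_def)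
      have ta: "term_value f ?x a = Fin (\<phi> a)" using tv[OF keys(1)] a(1) by (simp add: \<phi>_def)
      have tb: "term_value f ?x b = Fin (\<phi> a)" using tv[OF keys(2)] b(1) eq by (simp add: \<phi>_def)
      have "eval_trop f ?x = Min (term_value f ?x ` Poly_Mapping.keys f)"
        unfolding eval_trop_def using keys by (intro sum_trop_eq_Min) auto
      also have "\<dots> = Fin (\<phi> a)"
      proof (rule Min_eqI)
        show "Fin (\<phi> a) \<in> term_value f ?x ` Poly_Mapping.keys f" using ta keys(1) by (metis imageI)
        fix y assume "y \<in> term_value f ?x ` Poly_Mapping.keys f"
        then obtain c where c: "c \<in> Poly_Mapping.keys f" "y = term_value f ?x c" by blast
        show "Fin (\<phi> a) \<le> y"
          using a(2)[of c] unfolding c(2) tv[OF c(1)] by (simp add: \<phi>_def)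
      qed simp
      finally show ?thesis using keys ta tb b(2) by metis
    qed
    ultimately show ?thesis unfolding hypersurface_def by blast
  qed
  then have "?x \<in> variety n I" by (simp add: variety_def)
  then show ?thesis by blast
qed

end

section \<open>Choice of the stratum and conclusion\<close>

lemma exists_minimal_coordinate_set:
  assumes "\<not> has_monomial_on I {..<n} 0"
  obtains J where "J \<subseteq> {..<n}" "\<not> has_monomial_on I J 0" "\<And>i. i \<in> J \<Longrightarrow> has_monomial_on I (J - {i}) 0"
proof -
  let ?P = "\<lambda>J. J \<subseteq> {..<n} \<and> \<not> has_monomial_on I J 0"
  have "?P {..<n}" using assms by simp
  from ex_has_least_nat[of ?P, OF this, of card] obtain J where
    J: "?P J" "\<And>J'. ?P J' \<Longrightarrow> card J \<le> card J'" by blast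
  have "has_monomial_on I (J - {i}) 0" if "i \<in> J" for i
  proof (rule ccontr)
    assume "\<not> ?thesis"
    then have "card J \<le> card (J - {i})" using J by blast
    moreover have "finite J" using J(1) finite_subset by blast
    ultimately show False using that card_Diff1_less by fastforce
  qed
  with J(1) show thesis using that by blast
qed

theorem theorem1p4:
  fixes n :: nat and I :: "trop_poly set"
  assumes "tropical_ideal n I"
  shows "variety n I = {} \<longleftrightarrow> I = ideal_generated n {1}"
proof
  assume "I = ideal_generated n {1}"
  then have "1 \<in> I" by (simp add: ideal_generated_one trop_polys_def)
  \<comment> \<open>The polynomial 1 has one term, with the finite value 0 everywhere.\<close>
  moreover have "hypersurface n 1 = {}"
    by (auto simp: hypersurface_def eval_trop_def term_value_def one_trop_def)
  ultimately show "variety n I = {}" by (auto simp: variety_def)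
next
  assume empty: "variety n I = {}"
  show "I = ideal_generated n {1}"
  proof (rule ccontr)
    assume "I \<noteq> ideal_generated n {1}"
    then have "\<not> has_monomial_on I {..<n} 0" using one_in_ideal_if_constant[OF assms] by blast
    then obtain J where minimal: "J \<subseteq> {..<n}" "\<not> has_monomial_on I J 0"
      "\<And>i. i \<in> J \<Longrightarrow> has_monomial_on I (J - {i}) 0"
      using exists_minimal_coordinate_set by blast
    have "finite J" using minimal(1) finite_subset by blast
    then obtain \<sigma> where "bij_betw \<sigma> {0..<card J} J" using ex_bij_betw_nat_finite by blast
    then interpret coordinate_stratum n I J "card J" \<sigma>
      using assms minimal(1) by unfold_locales (simp_all add: atLeast0LessThan)
    have "variety n I \<noteq> {}"
    \<comment> \<open>Minimality of \<open>J\<close> upgrades the absence of constants to the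
      absence of all monomials.\<close>
    proof (rule exists_point_in_variety)
      fix a :: monom assume "Poly_Mapping.keys a \<subseteq> J"
      with assms minimal show "\<not> has_monomial_on I J a" by (rule no_monomial_if_no_constant)
    qed
    with empty show False by blast
  qed
qed

end
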